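(* Let $\mathcal L=(S,A,\to)$ be an NPLTS and $s_1,s_2\in S$. (1) If $\mathcal L$ is fully nondeterministic and only fully nondeterministic tests are admitted (in the definitions of $\sim_{\mathrm{PTe}\text{-}\sqcup\sqcap}$ and $\sim_{\mathrm{PTe}\text{-}\forall\exists}$), then $s_1\sim_{\mathrm{PTe}\text{-}\sqcup\sqcap}s_2\iff s_1\sim_{\mathrm{PTe}\text{-}\forall\exists}s_2\iff s_1\sim_{\mathrm{Te,fnd}}s_2$. (2) If $\mathcal L$ is fully probabilistic and only fully probabilistic tests are admitted, then $s_1\sim_{\mathrm{PTe}\text{-}\sqcup\sqcap}s_2\iff s_1\sim_{\mathrm{PTe}\text{-}\forall\exists}s_2\iff s_1\sim_{\mathrm{Te,fpr}}s_2$. (3) If $\mathcal L$ is reactive probabilistic and only reactive probabilistic tests are admitted, then $s_1\sim_{\mathrm{PTe}\text{-}\sqcup\sqcap}s_2$ implies $s_1\sim_{\mathrm{Te,rpr}}s_2$, and $s_1\sim_{\mathrm{PTe}\text{-}\forall\exists}s_2$ implies $s_1\sim_{\mathrm{Te,rpr}}s_2$.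
   Context: An NPLTS is a triple $(S,A,\to)$ where $S$ is an at most countable set of states, $A$ a countable set of actions, and $\to\subseteq S\times A\times\mathrm{Distr}(S)$ ($\mathrm{Distr}(S)$ = discrete probability distributions); write $s\xrightarrow{a}\mathcal D$, $\mathrm{supp}(\mathcal D)=\{s'\mid\mathcal D(s')>0\}$. It is fully nondeterministic if every transition's distribution is concentrated on a single state; fully probabilistic if each state has at most one outgoing transition; reactive probabilistic if no state has two distinct outgoing transitions with the same action. A computation from $s_0$ is a sequence $s_0\xrightarrow{a_1}s_1\cdots\xrightarrow{a_n}s_n$ with transitions $s_{i-1}\xrightarrow{a_i}\mathcal D_i$, $s_i\in\mathrm{supp}(\mathcal D_i)$; it is compatible with $\alpha$ if $a_1\cdots a_n=\alpha$; maximal if not a proper prefix of another computation from $s_0$. A resolution of a state $x$ (deterministic scheduler) is an NPLTS $\mathcal Z=(Z,A,\to_{\mathcal Z})$, obtained by unfolding from a state $z_x$, with $\mathrm{corr}$ mapping $Z$ to states, $\mathrm{corr}(z_x)=x$, such that for all $z$: (i) if $z\xrightarrow{a}_{\mathcal Z}\mathcal D$ then $\mathrm{corr}(z)\xrightarrow{a}\mathcal D'$ with $\mathcal D(z')=\mathcal D'(\mathrm{corr}(z'))$ for all $z'$; (ii) $z$ has at most one outgoing transition; maximal if it cannot be further extended in accordance with the graph structure and these constraints. $\mathrm{prob}(c)$ is the product of step probabilities, summed over sets of computations none a proper prefix of another. An NPT (test) is a finite acyclic NPLTS $\mathcal T=(O,A,\to_{\mathcal T})$ with a distinguished success state $\omega$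 without outgoing transitions; it is fully nondeterministic/fully probabilistic/reactive probabilistic as an NPLTS. The interaction system of $\mathcal L$ and $\mathcal T$ is the NPLTS on $S\times O$ with $(s,o)\xrightarrow{a}\mathcal D$ iff $s\xrightarrow{a}\mathcal D_1$, $o\xrightarrow{a}_{\mathcal T}\mathcal D_2$, $\mathcal D(s',o')=\mathcal D_1(s')\mathcal D_2(o')$. A computation is successful if its last configuration is $(s',\omega)$. $\mathrm{Res}_{\max}(s,o)$ is the set of maximal resolutions of $(s,o)$; $\mathcal{SC}(z_{s,o})$ the set of successful computations from $z_{s,o}$. $s_1\sim_{\mathrm{PTe}\text{-}\sqcup\sqcap}s_2$ iff for every admitted test with initial state $o$, $\sup$ and $\inf$ over $\mathcal Z\in\mathrm{Res}_{\max}(s_i,o)$ of $\mathrm{prob}(\mathcal{SC}(z_{s_i,o}))$ coincide for $i=1,2$. $s_1\sim_{\mathrm{PTe}\text{-}\forall\exists}s_2$ iff for every admitted test with initial state $o$, each $\mathcal Z_1\in\mathrm{Res}_{\max}(s_1,o)$ has $\mathcal Z_2\in\mathrm{Res}_{\max}(s_2,o)$ with equal $\mathrm{prob}(\mathcal{SC})$, and symmetrically. $s_1\sim_{\mathrm{Te,fnd}}s_2$ iff for every fully nondeterministic test with initial state $o$: there is a successful computation from $(s_1,o)$ iff there is one from $(s_2,o)$, and all maximal computations from $(s_1,o)$ are successful iff all maximal computations from $(s_2,o)$ are. $s_1\sim_{\mathrm{Te,fpr}}s_2$ iff for every fully probabilistic test with initial state $o$, $\mathrm{prob}(\mathcal{SC}(s_1,o))=\mathrm{prob}(\mathcal{SC}(s_2,o))$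 computed in the (fully probabilistic) interaction system. $s_1\sim_{\mathrm{Te,rpr}}s_2$ iff for every reactive probabilistic test with initial state $o$, $\sup_{\alpha\in\mathrm{Tr}_{\max}(s_1,o)}\mathrm{prob}(\mathcal{SCC}((s_1,o),\alpha))=\sup_{\alpha\in\mathrm{Tr}_{\max}(s_2,o)}\mathrm{prob}(\mathcal{SCC}((s_2,o),\alpha))$ and likewise for $\inf$, where $\mathrm{Tr}_{\max}(s,o)$ is the set of traces labeling maximal computations from $(s,o)$ and $\mathrm{prob}(\mathcal{SCC}((s,o),\alpha))$ is the probability of the successful $\alpha$-compatible computations from $(s,o)$, computed in the unique maximal resolution of $(s,o)$ containing all $\alpha$-compatible computations from $(s,o)$. *)

theory Defs
  imports "HOL-Probability.Probability" "HOL-Library.Sublist"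
begin

record ('s, 'a) nplts =
  states :: "'s set"
  actions :: "'a set"
  transitions :: "('s \<times> 'a \<times> 's pmf) set"

definition nplts :: "('s, 'a) nplts \<Rightarrow> bool" where
  "nplts N \<longleftrightarrow> countable (states N) \<and> countable (actions N) \<and>
     (\<forall>(s, a, D) \<in> transitions N. s \<in> states N \<and> a \<in> actions N \<and> set_pmf D \<subseteq> states N)"

definition fully_nondeterministic :: "('s, 'a) nplts \<Rightarrow> bool" where
  "fully_nondeterministic N \<longleftrightarrow> (\<forall>(s, a, D) \<in> transitions N. \<exists>s'. D = return_pmf s')"

definition fully_probabilistic :: "('s, 'a) nplts \<Rightarrow> bool" where
  "fully_probabilistic N \<longleftrightarrow>
     (\<forall>s a D a' D'. (s, a, D) \<in> transitions N \<and> (s, a', D') \<in> transitions N \<longrightarrow> a = a' \<and> D = D')"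

definition reactive_probabilistic :: "('s, 'a) nplts \<Rightarrow> bool" where
  "reactive_probabilistic N \<longleftrightarrow>
     (\<forall>s a D D'. (s, a, D) \<in> transitions N \<and> (s, a, D') \<in> transitions N \<longrightarrow> D = D')"


(* A computation from s0 is represented by the list [(a1, s1), ..., (an, sn)]. *)

type_synonym ('s, 'a) comp = "('a \<times> 's) list"

fun computation :: "('s, 'a) nplts \<Rightarrow> 's \<Rightarrow> ('s, 'a) comp \<Rightarrow> bool" where
  "computation N s [] \<longleftrightarrow> s \<in> states N"
| "computation N s ((a, s') # c) \<longleftrightarrow>
     (\<exists>D. (s, a, D) \<in> transitions N \<and> s' \<in> set_pmf D) \<and> computation N s' c"

definition last_state :: "'s \<Rightarrow> ('s, 'a) comp \<Rightarrow> 's" where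
  "last_state s c = last (s # map snd c)"

definition trace_of :: "('s, 'a) comp \<Rightarrow> 'a list" where
  "trace_of c = map fst c"

definition maximal_computation :: "('s, 'a) nplts \<Rightarrow> 's \<Rightarrow> ('s, 'a) comp \<Rightarrow> bool" where
  "maximal_computation N s c \<longleftrightarrow>
     computation N s c \<and> \<not> (\<exists>c'. computation N s c' \<and> strict_prefix c c')"

(* Meaningful only where source state and action determine the transition, which is the
   case in every system it is applied to: resolutions and fully probabilistic systems. *)
fun comp_prob :: "('s, 'a) nplts \<Rightarrow> 's \<Rightarrow> ('s, 'a) comp \<Rightarrow> real" where
  "comp_prob N s [] = 1"
| "comp_prob N s ((a, s') # c) =
     pmf (THE D. (s, a, D) \<in> transitions N) s' * comp_prob N s' c"

definition prob_of :: "('s, 'a) nplts \<Rightarrow> 's \<Rightarrow> ('s, 'a) comp set \<Rightarrow> real" where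
  "prob_of N s C = (\<Sum>\<^sub>\<infinity>c\<in>C. comp_prob N s c)"


(* State sets are at most countable, so taking the states of a resolution
   from nat loses no resolution up to isomorphism. *)
record ('s, 'a) resolution =
  graph :: "(nat, 'a) nplts"
  root :: nat
  corr :: "nat \<Rightarrow> 's"

(* The uniqueness condition on computations from the root says that the resolution is an
   unfolding, i.e. a tree. As several of its states may then correspond to the same state of N,
   D z' = D' (corr z') is required for the z' in the support of D, which contains exactly one
   copy of each state in the support of D'. *)
definition resolution_of :: "('s, 'a) nplts \<Rightarrow> 's \<Rightarrow> ('s, 'a) resolution \<Rightarrow> bool" where
  "resolution_of N x Z \<longleftrightarrow>
     nplts (graph Z) \<and> actions (graph Z) = actions N \<and>
     root Z \<in> states (graph Z) \<and> corr Z (root Z) = x \<and>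
     corr Z ` states (graph Z) \<subseteq> states N \<and>
     (\<forall>z \<in> states (graph Z). \<exists>!c. computation (graph Z) (root Z) c \<and> last_state (root Z) c = z) \<and>
     (\<forall>z a D. (z, a, D) \<in> transitions (graph Z) \<longrightarrow>
        (\<exists>D'. (corr Z z, a, D') \<in> transitions N \<and>
              bij_betw (corr Z) (set_pmf D) (set_pmf D') \<and>
              (\<forall>z' \<in> set_pmf D. pmf D z' = pmf D' (corr Z z')))) \<and>
     (\<forall>z a1 D1 a2 D2. (z, a1, D1) \<in> transitions (graph Z) \<and> (z, a2, D2) \<in> transitions (graph Z) \<longrightarrow>
        a1 = a2 \<and> D1 = D2)"

definition embeds :: "(nat \<Rightarrow> nat) \<Rightarrow> ('s, 'a) resolution \<Rightarrow> ('s, 'a) resolution \<Rightarrow> bool" where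
  "embeds f Z Z' \<longleftrightarrow>
     inj_on f (states (graph Z)) \<and> f ` states (graph Z) \<subseteq> states (graph Z') \<and>
     f (root Z) = root Z' \<and>
     (\<forall>z \<in> states (graph Z). corr Z' (f z) = corr Z z) \<and>
     (\<lambda>(z, a, D). (f z, a, map_pmf f D)) ` transitions (graph Z) \<subseteq> transitions (graph Z')"

(* Extension is taken up to renaming of states: otherwise a resolution that uses up
   all of nat could not be extended merely for lack of fresh states. *)
definition proper_extension :: "('s, 'a) resolution \<Rightarrow> ('s, 'a) resolution \<Rightarrow> bool" where
  "proper_extension Z Z' \<longleftrightarrow>
     (\<exists>f. embeds f Z Z' \<and>
        (f ` states (graph Z) \<noteq> states (graph Z') \<or>
         (\<lambda>(z, a, D). (f z, a, map_pmf f D)) ` transitions (graph Z) \<noteq> transitions (graph Z')))"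

definition Res :: "('s, 'a) nplts \<Rightarrow> 's \<Rightarrow> ('s, 'a) resolution set" where
  "Res N x = {Z. resolution_of N x Z}"

definition Res_max :: "('s, 'a) nplts \<Rightarrow> 's \<Rightarrow> ('s, 'a) resolution set" where
  "Res_max N x = {Z \<in> Res N x. \<not> (\<exists>Z' \<in> Res N x. proper_extension Z Z')}"


definition step_relation :: "('s, 'a) nplts \<Rightarrow> ('s \<times> 's) set" where
  "step_relation N = {(s, s'). \<exists>a D. (s, a, D) \<in> transitions N \<and> s' \<in> set_pmf D}"

(* npt A T w: T is a test over the actions A with success state w. Tests are finite, so
   taking their states from nat loses no test up to isomorphism. *)
definition npt :: "'a set \<Rightarrow> (nat, 'a) nplts \<Rightarrow> nat \<Rightarrow> bool" where
  "npt A T w \<longleftrightarrow>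
     nplts T \<and> actions T = A \<and>
     finite (states T) \<and> finite (transitions T) \<and> acyclic (step_relation T) \<and>
     w \<in> states T \<and> (\<forall>a D. (w, a, D) \<notin> transitions T)"

definition interaction :: "('s, 'a) nplts \<Rightarrow> (nat, 'a) nplts \<Rightarrow> ('s \<times> nat, 'a) nplts" where
  "interaction L T =
     \<lparr> states = states L \<times> states T,
       actions = actions L,
       transitions = {((s, q), a, pair_pmf D1 D2) | s q a D1 D2.
                        (s, a, D1) \<in> transitions L \<and> (q, a, D2) \<in> transitions T} \<rparr>"

definition SC :: "('s \<times> nat, 'a) nplts \<Rightarrow> nat \<Rightarrow> 's \<times> nat \<Rightarrow> ('s \<times> nat, 'a) comp set" where
  "SC N w x = {c. computation N x c \<and> snd (last_state x c) = w}"

definition SC_res :: "nat \<Rightarrow> ('s \<times> nat, 'a) resolution \<Rightarrow> (nat, 'a) comp set" where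
  "SC_res w Z = {c. computation (graph Z) (root Z) c \<and> snd (corr Z (last_state (root Z) c)) = w}"

definition success_prob :: "nat \<Rightarrow> ('s \<times> nat, 'a) resolution \<Rightarrow> real" where
  "success_prob w Z = prob_of (graph Z) (root Z) (SC_res w Z)"


(* The parameter Adm of the following two relations is the class of admitted tests. *)

definition PTe_supinf :: "((nat, 'a) nplts \<Rightarrow> bool) \<Rightarrow> ('s, 'a) nplts \<Rightarrow> 's \<Rightarrow> 's \<Rightarrow> bool" where
  "PTe_supinf Adm L s1 s2 \<longleftrightarrow>
     (\<forall>T w q. npt (actions L) T w \<and> Adm T \<and> q \<in> states T \<longrightarrow>
        (SUP Z \<in> Res_max (interaction L T) (s1, q). success_prob w Z) =
        (SUP Z \<in> Res_max (interaction L T) (s2, q). success_prob w Z) \<and>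
        (INF Z \<in> Res_max (interaction L T) (s1, q). success_prob w Z) =
        (INF Z \<in> Res_max (interaction L T) (s2, q). success_prob w Z))"

definition PTe_forall_exists :: "((nat, 'a) nplts \<Rightarrow> bool) \<Rightarrow> ('s, 'a) nplts \<Rightarrow> 's \<Rightarrow> 's \<Rightarrow> bool" where
  "PTe_forall_exists Adm L s1 s2 \<longleftrightarrow>
     (\<forall>T w q. npt (actions L) T w \<and> Adm T \<and> q \<in> states T \<longrightarrow>
        (\<forall>Z1 \<in> Res_max (interaction L T) (s1, q). \<exists>Z2 \<in> Res_max (interaction L T) (s2, q).
           success_prob w Z1 = success_prob w Z2) \<and>
        (\<forall>Z2 \<in> Res_max (interaction L T) (s2, q). \<exists>Z1 \<in> Res_max (interaction L T) (s1, q).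
           success_prob w Z2 = success_prob w Z1))"

definition Te_fnd :: "('s, 'a) nplts \<Rightarrow> 's \<Rightarrow> 's \<Rightarrow> bool" where
  "Te_fnd L s1 s2 \<longleftrightarrow>
     (\<forall>T w q. npt (actions L) T w \<and> fully_nondeterministic T \<and> q \<in> states T \<longrightarrow>
        (SC (interaction L T) w (s1, q) \<noteq> {} \<longleftrightarrow> SC (interaction L T) w (s2, q) \<noteq> {}) \<and>
        ((\<forall>c. maximal_computation (interaction L T) (s1, q) c \<longrightarrow>
              c \<in> SC (interaction L T) w (s1, q)) \<longleftrightarrow>
         (\<forall>c. maximal_computation (interaction L T) (s2, q) c \<longrightarrow>
              c \<in> SC (interaction L T) w (s2, q))))"

definition Te_fpr :: "('s, 'a) nplts \<Rightarrow> 's \<Rightarrow> 's \<Rightarrow> bool" where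
  "Te_fpr L s1 s2 \<longleftrightarrow>
     (\<forall>T w q. npt (actions L) T w \<and> fully_probabilistic T \<and> q \<in> states T \<longrightarrow>
        prob_of (interaction L T) (s1, q) (SC (interaction L T) w (s1, q)) =
        prob_of (interaction L T) (s2, q) (SC (interaction L T) w (s2, q)))"

definition Tr_max :: "('s, 'a) nplts \<Rightarrow> 's \<Rightarrow> 'a list set" where
  "Tr_max N x = {trace_of c | c. maximal_computation N x c}"

definition contains_compatible :: "('s, 'a) nplts \<Rightarrow> 's \<Rightarrow> 'a list \<Rightarrow> ('s, 'a) resolution \<Rightarrow> bool" where
  "contains_compatible N x \<alpha> Z \<longleftrightarrow>
     (\<forall>c. computation N x c \<and> trace_of c = \<alpha> \<longrightarrow>
        (\<exists>c'. computation (graph Z) (root Z) c' \<and> map (map_prod id (corr Z)) c' = c))"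

(* A maximal resolution containing all alpha-compatible computations is unique only up to its
   behaviour off these computations, which does not affect the probability taken here. *)
definition SCC_prob :: "('s \<times> nat, 'a) nplts \<Rightarrow> nat \<Rightarrow> 's \<times> nat \<Rightarrow> 'a list \<Rightarrow> real" where
  "SCC_prob N w x \<alpha> =
     (THE p. \<exists>Z \<in> Res_max N x. contains_compatible N x \<alpha> Z \<and>
        p = prob_of (graph Z) (root Z) {c \<in> SC_res w Z. trace_of c = \<alpha>})"

definition Te_rpr :: "('s, 'a) nplts \<Rightarrow> 's \<Rightarrow> 's \<Rightarrow> bool" where
  "Te_rpr L s1 s2 \<longleftrightarrow>
     (\<forall>T w q. npt (actions L) T w \<and> reactive_probabilistic T \<and> q \<in> states T \<longrightarrow>
        (SUP \<alpha> \<in> Tr_max (interaction L T) (s1, q). SCC_prob (interaction L T) w (s1, q) \<alpha>) =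
        (SUP \<alpha> \<in> Tr_max (interaction L T) (s2, q). SCC_prob (interaction L T) w (s2, q) \<alpha>) \<and>
        (INF \<alpha> \<in> Tr_max (interaction L T) (s1, q). SCC_prob (interaction L T) w (s1, q) \<alpha>) =
        (INF \<alpha> \<in> Tr_max (interaction L T) (s2, q). SCC_prob (interaction L T) w (s2, q) \<alpha>))"

end

theory Submission
  imports Defs
begin

text \<open>
  A resolution is maximal iff it moves in every state whose counterpart moves, and every
  history-dependent scheduler is realised by a maximal resolution on (encoded) histories.

  Fully nondeterministic case: maximal resolutions are single maximal computations, so the set of
  success probabilities is a nonempty subset of \<open>{0, 1}\<close>; each of the three equivalences
  says exactly that these sets coincide for the two states.

  Fully probabilistic case: the computations of any maximal resolution biject with those of the
  interaction system, so all maximal resolutions have the same success probability.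

  Reactive case: for a trace \<open>\<alpha>\<close>, a test can be cut down so that it only follows \<open>\<alpha>\<close> and
  then either succeeds in one chosen test state \<open>r\<close>, or succeeds after any further action possible in
  \<open>r\<close>. Although the latter leaves a choice, every maximal resolution has the same success probability:
  that of ending in \<open>r\<close> after \<open>\<alpha>\<close>, respectively of ending there without deadlock. The former gives the
  probability of the successful \<open>\<alpha>\<close>-compatible computations, and comparing the two detects
  whether \<open>\<alpha>\<close> labels a maximal computation.
\<close>

section \<open>Computations and resolutions\<close>

lemma last_state_Nil [simp]: "last_state s [] = s"
  by (simp add: last_state_def)

lemma last_state_Cons [simp]: "last_state s ((a, s') # c) = last_state s' c"
  by (simp add: last_state_def)

lemma last_state_snoc [simp]: "last_state s (c @ [(a, s')]) = s'"
  by (simp add: last_state_def)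

lemma nplts_transD:
  assumes "nplts N" "(s, a, D) \<in> transitions N"
  shows "s \<in> states N" "a \<in> actions N" "set_pmf D \<subseteq> states N"
  using assms unfolding nplts_def by auto

lemma computation_append:
  "computation N s (c @ d) \<Longrightarrow> computation N (last_state s c) d"
  by (induction N s c rule: computation.induct) auto

lemma computation_start: "nplts N \<Longrightarrow> computation N s c \<Longrightarrow> s \<in> states N"
  by (cases c) (auto dest: nplts_transD)

lemma computation_last:
  "computation N s c \<Longrightarrow> last_state s c \<in> states N"
  by (induction N s c rule: computation.induct) auto

lemma computation_snoc:
  assumes "nplts N"
  shows "computation N s (c @ [(a, s')]) \<longleftrightarrow>
    computation N s c \<and> (\<exists>D. (last_state s c, a, D) \<in> transitions N \<and> s' \<in> set_pmf D)"
  using assms by (induction N s c rule: computation.induct) (auto dest: nplts_transD)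

lemma maximal_computation_iff:
  assumes "nplts N"
  shows "maximal_computation N s c \<longleftrightarrow>
    computation N s c \<and> (\<forall>a D. (last_state s c, a, D) \<notin> transitions N)"
proof (cases "computation N s c")
  case True
  have "(\<exists>c'. computation N s c' \<and> strict_prefix c c') \<longleftrightarrow> (\<exists>a D. (last_state s c, a, D) \<in> transitions N)"
  proof
    assume "\<exists>c'. computation N s c' \<and> strict_prefix c c'"
    then obtain a s' d where "computation N s (c @ (a, s') # d)"
      by (metis strict_prefixE' surj_pair)
    from computation_append[OF this] show "\<exists>a D. (last_state s c, a, D) \<in> transitions N" by auto
  next
    assume "\<exists>a D. (last_state s c, a, D) \<in> transitions N"
    \<comment> \<open>Supports of distributions are nonempty, so an available transition always
      prolongs the computation.\<close>
    then obtain a D s' where "(last_state s c, a, D) \<in> transitions N" "s' \<in> set_pmf D"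
      using set_pmf_not_empty by fast
    with True have "computation N s (c @ [(a, s')])" by (auto simp: computation_snoc[OF assms])
    then show "\<exists>c'. computation N s c' \<and> strict_prefix c c'" by (meson strict_prefixI' )
  qed
  with True show ?thesis by (simp add: maximal_computation_def)
qed (simp add: maximal_computation_def)

section \<open>Local forms of the tree and distribution conditions on resolutions\<close>

text \<open>Two computations from the root with the same end can be compared from their last steps
  backwards: a unique incoming edge determines the previous state and action, and the root has no
  incoming edge. This replaces uniqueness of whole computations by conditions on single
  transitions.\<close>

lemma tree_iff:
  assumes N: "nplts N" and r: "r \<in> states N"
  shows "(\<forall>z \<in> states N. \<exists>!c. computation N r c \<and> last_state r c = z) \<longleftrightarrow>
    (\<forall>z \<in> states N. \<exists>c. computation N r c \<and> last_state r c = z) \<and>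
    (\<forall>z a D. (z, a, D) \<in> transitions N \<longrightarrow> r \<notin> set_pmf D) \<and>
    (\<forall>z a D z' a' D' y. (z, a, D) \<in> transitions N \<and> (z', a', D') \<in> transitions N \<and>
       y \<in> set_pmf D \<and> y \<in> set_pmf D' \<longrightarrow> z = z' \<and> a = a')" (is "?L \<longleftrightarrow> ?R")
proof
  assume L: ?L
  have uniq: "c = c'" if "computation N r c" "computation N r c'" "last_state r c = last_state r c'" for c c'
    using L that computation_last by metis
  \<comment> \<open>A computation reaching \<open>z\<close> prolongs into each state of the support;
    two prolongations meeting in one state must be equal, which yields both local
    conditions.\<close>
  have ext: "\<exists>c. computation N r c \<and> last_state r c = z \<and> (\<forall>y \<in> set_pmf D. computation N r (c @ [(a, y)]))"
    if t: "(z, a, D) \<in> transitions N" for z a D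
  proof -
    have "z \<in> states N" using nplts_transD[OF N t] by simp
    then obtain c where "computation N r c" "last_state r c = z" using L by blast
    with t show ?thesis by (auto simp: computation_snoc[OF N])
  qed
  have "r \<notin> set_pmf D" if t: "(z, a, D) \<in> transitions N" for z a D
  proof
    assume "r \<in> set_pmf D"
    with ext[OF t] obtain c where "computation N r (c @ [(a, r)])" by blast
    from uniq[OF this, of "[]"] r show False by simp
  qed
  moreover have "z = z' \<and> a = a'"
    if t: "(z, a, D) \<in> transitions N" and t': "(z', a', D') \<in> transitions N"
      and y: "y \<in> set_pmf D" "y \<in> set_pmf D'" for z a D z' a' D' y
  proof -
    obtain c where c: "last_state r c = z" "computation N r (c @ [(a, y)])" using ext[OF t] y by blast
    obtain c' where c': "last_state r c' = z'" "computation N r (c' @ [(a', y)])" using ext[OF t'] y by blast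
    have "c @ [(a, y)] = c' @ [(a', y)]" by (rule uniq[OF c(2) c'(2)]) simp
    then show ?thesis using c c' by auto
  qed
  ultimately show ?R using L by (intro conjI ballI allI impI) (metis+)
next
  assume ?R
  then have reach: "\<And>z. z \<in> states N \<Longrightarrow> \<exists>c. computation N r c \<and> last_state r c = z"
    and nroot: "\<And>z a D. (z, a, D) \<in> transitions N \<Longrightarrow> r \<notin> set_pmf D"
    and pred: "\<And>z a D z' a' D' y. (z, a, D) \<in> transitions N \<Longrightarrow> (z', a', D') \<in> transitions N \<Longrightarrow>
       y \<in> set_pmf D \<Longrightarrow> y \<in> set_pmf D' \<Longrightarrow> z = z' \<and> a = a'" by simp_all metis+
  have uniq: "computation N r c \<Longrightarrow> computation N r c' \<Longrightarrow> last_state r c = last_state r c' \<Longrightarrow> c = c'" for c c'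
  proof (induction c arbitrary: c' rule: rev_induct)
    case Nil
    show ?case
    proof (cases c' rule: rev_cases)
      case (snoc d p)
      then show ?thesis using Nil nroot by (cases p) (auto simp: computation_snoc[OF N])
    qed simp
  next
    case (snoc p c)
    obtain a y where p: "p = (a, y)" by (cases p)
    obtain D where D: "computation N r c" "(last_state r c, a, D) \<in> transitions N" "y \<in> set_pmf D"
      using snoc.prems by (auto simp: computation_snoc[OF N] p)
    show ?case
    proof (cases c' rule: rev_cases)
      case Nil
      then show ?thesis using snoc.prems nroot D p by auto
    next
      case (snoc d p')
      obtain a' y' where p': "p' = (a', y')" by (cases p')
      have y': "y' = y" using snoc.prems snoc p p' by simp
      obtain D' where D': "computation N r d" "(last_state r d, a', D') \<in> transitions N" "y \<in> set_pmf D'"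
        using snoc.prems by (auto simp: computation_snoc[OF N] p' snoc y')
      have "last_state r c = last_state r d \<and> a = a'" using pred D D' by metis
      with snoc.IH[OF D(1) D'(1)] show ?thesis by (simp add: snoc p p' y')
    qed
  qed
  show ?L
  proof
    fix z assume "z \<in> states N"
    then obtain c where "computation N r c" "last_state r c = z" using reach by metis
    then show "\<exists>!c. computation N r c \<and> last_state r c = z" using uniq by metis
  qed
qed

text \<open>Restates the distribution clause of \<open>resolution_of\<close>: being injective on the
  support, \<open>f\<close> never adds up the weights of two points, so preserving weights pointwise
  amounts to a push-forward.\<close>

lemma bij_betw_pmf_iff:
  "bij_betw f (set_pmf D) (set_pmf D') \<and> (\<forall>z \<in> set_pmf D. pmf D z = pmf D' (f z)) \<longleftrightarrow>
   inj_on f (set_pmf D) \<and> map_pmf f D = D'" (is "?L \<longleftrightarrow> ?R")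
proof
  assume L: ?L
  then have inj: "inj_on f (set_pmf D)" and img: "f ` set_pmf D = set_pmf D'"
    by (auto simp: bij_betw_def)
  have "pmf (map_pmf f D) y = pmf D' y" for y
  proof (cases "y \<in> set_pmf D'")
    case True
    then obtain z where "z \<in> set_pmf D" "y = f z" using img by auto
    with L inj show ?thesis by (simp add: pmf_map_inj)
  next
    case False
    then have "y \<notin> set_pmf (map_pmf f D)" using img by simp
    with False show ?thesis by (metis set_pmf_iff)
  qed
  then show ?R using inj by (auto intro: pmf_eqI)
next
  assume ?R
  then show ?L by (auto simp: bij_betw_def pmf_map_inj)
qed

section \<open>Projecting computations of a resolution to the underlying system\<close>

definition corr_comp :: "('s, 'a) resolution \<Rightarrow> (nat, 'a) comp \<Rightarrow> ('s, 'a) comp" where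
  "corr_comp Z c = map (map_prod id (corr Z)) c"

lemma corr_comp_simps [simp]:
  "corr_comp Z [] = []"
  "corr_comp Z ((a, z) # c) = (a, corr Z z) # corr_comp Z c"
  "corr_comp Z (c @ d) = corr_comp Z c @ corr_comp Z d"
  by (simp_all add: corr_comp_def)

lemma trace_corr_comp [simp]: "trace_of (corr_comp Z c) = trace_of c"
  by (simp add: trace_of_def corr_comp_def comp_def)

locale resolution =
  fixes N :: "('s, 'a) nplts" and x :: 's and Z :: "('s, 'a) resolution"
  assumes nplts_N: "nplts N" and res: "resolution_of N x Z"
begin

abbreviation "G \<equiv> graph Z"
abbreviation "cmap \<equiv> corr_comp Z"

lemma nplts_G: "nplts G"
  and actions_G: "actions G = actions N"
  and root_state: "root Z \<in> states G"
  and corr_root: "corr Z (root Z) = x"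
  and corr_states: "corr Z ` states G \<subseteq> states N"
  and tree: "\<forall>z \<in> states G. \<exists>!c. computation G (root Z) c \<and> last_state (root Z) c = z"
  and corr_pmf: "\<forall>z a D. (z, a, D) \<in> transitions G \<longrightarrow>
        (\<exists>D'. (corr Z z, a, D') \<in> transitions N \<and>
              bij_betw (corr Z) (set_pmf D) (set_pmf D') \<and>
              (\<forall>z' \<in> set_pmf D. pmf D z' = pmf D' (corr Z z')))"
  and trans_unique_raw: "\<forall>z a1 D1 a2 D2. (z, a1, D1) \<in> transitions G \<and> (z, a2, D2) \<in> transitions G \<longrightarrow>
        a1 = a2 \<and> D1 = D2"
  by (insert res, unfold resolution_of_def, (elim conjE, assumption)+)

lemma corr_state: "z \<in> states G \<Longrightarrow> corr Z z \<in> states N"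
  using corr_states by auto

lemma trans_unique:
  "(z, a1, D1) \<in> transitions G \<Longrightarrow> (z, a2, D2) \<in> transitions G \<Longrightarrow> a1 = a2 \<and> D1 = D2"
  using trans_unique_raw by metis

lemma corr_trans:
  assumes "(z, a, D) \<in> transitions G"
  shows "(corr Z z, a, map_pmf (corr Z) D) \<in> transitions N" "inj_on (corr Z) (set_pmf D)"
proof -
  obtain D' where "(corr Z z, a, D') \<in> transitions N"
    "bij_betw (corr Z) (set_pmf D) (set_pmf D') \<and> (\<forall>z' \<in> set_pmf D. pmf D z' = pmf D' (corr Z z'))"
    using corr_pmf assms by metis
  then show "(corr Z z, a, map_pmf (corr Z) D) \<in> transitions N" "inj_on (corr Z) (set_pmf D)"
    unfolding bij_betw_pmf_iff by auto
qed

lemma the_trans: "(z, a, D) \<in> transitions G \<Longrightarrow> (THE D. (z, a, D) \<in> transitions G) = D"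
  by (rule the_equality) (auto dest: trans_unique)

lemma corr_last_state: "corr Z (last_state z c) = last_state (corr Z z) (cmap c)"
  by (induction c arbitrary: z) auto

lemma computation_cmap:
  "computation G z c \<Longrightarrow> computation N (corr Z z) (cmap c)"
proof (induction c arbitrary: z)
  case Nil
  then show ?case using corr_state by simp
next
  case (Cons p c)
  then show ?case using corr_trans by (cases p) force
qed

text \<open>A state of the resolution has no choice of transition, and on the support of that
  transition \<open>corr Z\<close> separates states; so the projected steps determine the steps, one
  after another.\<close>

lemma inj_on_cmap: "inj_on cmap {c. computation G z c}"
proof -
  have "computation G z c \<Longrightarrow> computation G z d \<Longrightarrow> cmap c = cmap d \<Longrightarrow> c = d" for c d z
  proof (induction c arbitrary: d z)
    case Nil
    then show ?case by (cases d) auto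
  next
    case (Cons p c)
    obtain a z' where p: "p = (a, z')" by (cases p)
    obtain a2 z2 e where d: "d = (a2, z2) # e" using Cons.prems p by (cases d) auto
    obtain D where D: "(z, a, D) \<in> transitions G" "z' \<in> set_pmf D" using Cons.prems p by auto
    obtain D2 where D2: "(z, a2, D2) \<in> transitions G" "z2 \<in> set_pmf D2" using Cons.prems d by auto
    have "a2 = a" "D2 = D" using trans_unique D D2 by blast+
    moreover have "corr Z z' = corr Z z2" using Cons.prems p d by simp
    ultimately have "z' = z2" using corr_trans(2)[OF D(1)] D D2 by (auto dest: inj_onD)
    then show ?case using Cons p d \<open>a2 = a\<close> by auto
  qed
  then show ?thesis by (auto intro: inj_onI)
qed

text \<open>Reactivity makes the \<open>THE\<close> in \<open>comp_prob\<close> denote, in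
  \<open>N\<close>, the push-forward of the distribution used in the resolution; injectivity on the
  support then keeps each factor of the product.\<close>

lemma comp_prob_cmap:
  assumes "reactive_probabilistic N"
  shows "computation G z c \<Longrightarrow> comp_prob N (corr Z z) (cmap c) = comp_prob G z c"
proof (induction c arbitrary: z)
  case (Cons p c)
  obtain a z' where p: "p = (a, z')" by (cases p)
  obtain D where D: "(z, a, D) \<in> transitions G" "z' \<in> set_pmf D" using Cons.prems p by auto
  have "(THE D. (corr Z z, a, D) \<in> transitions N) = map_pmf (corr Z) D"
    by (rule the_equality) (use corr_trans(1)[OF D(1)] assms in \<open>auto simp: reactive_probabilistic_def\<close>)
  then show ?case using Cons p D corr_trans(2)[OF D(1)]
    by (simp add: the_trans pmf_map_inj)
qed simp

end

section \<open>Maximal resolutions\<close>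

definition enabled :: "('s, 'a) nplts \<Rightarrow> 's \<Rightarrow> bool" where
  "enabled N s \<longleftrightarrow> (\<exists>a D. (s, a, D) \<in> transitions N)"

text \<open>Collects the local forms given by \<open>tree_iff\<close> and
  \<open>bij_betw_pmf_iff\<close>, so that a constructed graph can be checked one transition at a
  time.\<close>

lemma resolution_ofI:
  assumes G: "nplts (graph Z)" "actions (graph Z) = actions N"
    and root: "root Z \<in> states (graph Z)" "corr Z (root Z) = x"
    and corr: "corr Z ` states (graph Z) \<subseteq> states N"
    and reach: "\<And>z. z \<in> states (graph Z) \<Longrightarrow>
      \<exists>c. computation (graph Z) (root Z) c \<and> last_state (root Z) c = z"
    and nroot: "\<And>z a D. (z, a, D) \<in> transitions (graph Z) \<Longrightarrow> root Z \<notin> set_pmf D"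
    and pred: "\<And>z a D z' a' D' y. (z, a, D) \<in> transitions (graph Z) \<Longrightarrow>
      (z', a', D') \<in> transitions (graph Z) \<Longrightarrow> y \<in> set_pmf D \<Longrightarrow> y \<in> set_pmf D' \<Longrightarrow> z = z' \<and> a = a'"
    and trans: "\<And>z a D. (z, a, D) \<in> transitions (graph Z) \<Longrightarrow>
      (corr Z z, a, map_pmf (corr Z) D) \<in> transitions N \<and> inj_on (corr Z) (set_pmf D)"
    and uniq: "\<And>z a1 D1 a2 D2. (z, a1, D1) \<in> transitions (graph Z) \<Longrightarrow>
      (z, a2, D2) \<in> transitions (graph Z) \<Longrightarrow> a1 = a2 \<and> D1 = D2"
  shows "resolution_of N x Z"
proof -
  have "\<forall>z \<in> states (graph Z). \<exists>!c. computation (graph Z) (root Z) c \<and> last_state (root Z) c = z"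
    unfolding tree_iff[OF G(1) root(1)] using reach nroot pred
    by (intro conjI ballI allI impI) (metis+)
  moreover have "\<forall>z a D. (z, a, D) \<in> transitions (graph Z) \<longrightarrow>
        (\<exists>D'. (corr Z z, a, D') \<in> transitions N \<and>
              bij_betw (corr Z) (set_pmf D) (set_pmf D') \<and>
              (\<forall>z' \<in> set_pmf D. pmf D z' = pmf D' (corr Z z')))"
  proof (intro allI impI)
    fix z a D assume "(z, a, D) \<in> transitions (graph Z)"
    from trans[OF this] show "\<exists>D'. (corr Z z, a, D') \<in> transitions N \<and>
              bij_betw (corr Z) (set_pmf D) (set_pmf D') \<and>
              (\<forall>z' \<in> set_pmf D. pmf D z' = pmf D' (corr Z z'))"
      using bij_betw_pmf_iff[of "corr Z" D "map_pmf (corr Z) D"] by blast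
  qed
  moreover have "\<forall>z a1 D1 a2 D2. (z, a1, D1) \<in> transitions (graph Z) \<and> (z, a2, D2) \<in> transitions (graph Z) \<longrightarrow>
        a1 = a2 \<and> D1 = D2"
    using uniq by metis
  ultimately show ?thesis
    unfolding resolution_of_def by (intro conjI G root corr) assumption+
qed

context resolution
begin

lemma reachable: "z \<in> states G \<Longrightarrow> \<exists>c. computation G (root Z) c \<and> last_state (root Z) c = z"
  using tree by metis

lemma root_not_in_support: "(z, a, D) \<in> transitions G \<Longrightarrow> root Z \<notin> set_pmf D"
  using tree unfolding tree_iff[OF nplts_G root_state] by metis

lemma pred_unique: "(z, a, D) \<in> transitions G \<Longrightarrow> (z', a', D') \<in> transitions G \<Longrightarrow>
    y \<in> set_pmf D \<Longrightarrow> y \<in> set_pmf D' \<Longrightarrow> z = z' \<and> a = a'"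
  using tree unfolding tree_iff[OF nplts_G root_state] by metis

text \<open>If \<open>Z\<close> moves wherever its counterpart can, an extension has nothing to add:
  each image state already carries its only possible transition, so nothing outside the image is
  reachable from the root.\<close>

lemma Res_maxI:
  assumes max: "\<And>z. z \<in> states G \<Longrightarrow> enabled N (corr Z z) \<Longrightarrow> enabled G z"
  shows "Z \<in> Res_max N x"
proof -
  have False if Z': "Z' \<in> Res N x" "proper_extension Z Z'" for Z'
  proof -
    interpret R: resolution N x Z'
      using Z' nplts_N by unfold_locales (auto simp: Res_def)
    obtain f where f: "embeds f Z Z'" and ne: "f ` states G \<noteq> states (graph Z') \<or>
         (\<lambda>(z, a, D). (f z, a, map_pmf f D)) ` transitions G \<noteq> transitions (graph Z')"
      using Z' unfolding proper_extension_def by blast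
    have fs: "f ` states G \<subseteq> states (graph Z')" and fr: "f (root Z) = root Z'"
      and fc: "\<And>z. z \<in> states G \<Longrightarrow> corr Z' (f z) = corr Z z"
      and ft: "\<And>z a D. (z, a, D) \<in> transitions G \<Longrightarrow> (f z, a, map_pmf f D) \<in> transitions (graph Z')"
      using f unfolding embeds_def by auto
    \<comment> \<open>A move of \<open>Z'\<close> at an image state projects to a move of
      \<open>N\<close>, so \<open>Z\<close> moves there too; as \<open>Z'\<close> has at most one
      transition per state, its move is the image of that of \<open>Z\<close>.\<close>
    have lift: "\<exists>D0. (z, a, D0) \<in> transitions G \<and> D = map_pmf f D0"
      if z: "z \<in> states G" and t: "(f z, a, D) \<in> transitions (graph Z')" for z a D
    proof -
      have "enabled N (corr Z z)"
        using R.corr_trans(1)[OF t] fc[OF z] by (auto simp: enabled_def)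
      then have "enabled G z" by (rule max[OF z])
      then obtain a0 D0 where D0: "(z, a0, D0) \<in> transitions G" by (auto simp: enabled_def)
      with R.trans_unique[OF t ft[OF D0]] show ?thesis by auto
    qed
    have "computation (graph Z') (root Z') c \<Longrightarrow> last_state (root Z') c \<in> f ` states G" for c
    proof (induction c rule: rev_induct)
      case Nil
      then show ?case using fr root_state by (metis imageI last_state_Nil)
    next
      case (snoc p c)
      obtain a y where p: "p = (a, y)" by (cases p)
      obtain D where D: "computation (graph Z') (root Z') c"
        "(last_state (root Z') c, a, D) \<in> transitions (graph Z')" "y \<in> set_pmf D"
        using snoc.prems by (auto simp: computation_snoc[OF R.nplts_G] p)
      obtain z where z: "z \<in> states G" "last_state (root Z') c = f z" using snoc.IH[OF D(1)] by auto
      obtain D0 where D0: "(z, a, D0) \<in> transitions G" "D = map_pmf f D0" using lift z D(2) by metis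
      then show ?case using D(3) p nplts_transD(3)[OF nplts_G D0(1)] by auto
    qed
    then have "states (graph Z') \<subseteq> f ` states G" using R.reachable by (metis subsetI)
    with fs have st: "f ` states G = states (graph Z')" by (rule subset_antisym)
    have "transitions (graph Z') \<subseteq> (\<lambda>(z, a, D). (f z, a, map_pmf f D)) ` transitions G"
    proof
      fix t assume "t \<in> transitions (graph Z')"
      moreover obtain z' a D where t: "t = (z', a, D)" by (cases t)
      ultimately have t': "(z', a, D) \<in> transitions (graph Z')" by simp
      then obtain z where z: "z \<in> states G" "z' = f z"
        using nplts_transD[OF R.nplts_G] st by blast
      then obtain D0 where "(z, a, D0) \<in> transitions G" "D = map_pmf f D0" using lift t' by metis
      then show "t \<in> (\<lambda>(z, a, D). (f z, a, map_pmf f D)) ` transitions G"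
        using z t by force
    qed
    then show False using ne st ft by auto
  qed
  then show ?thesis using res by (auto simp: Res_max_def Res_def)
qed

text \<open>Converse of \<open>Res_maxI\<close>: a dead state whose counterpart can move could be
  given the missing transition by grafting fresh copies of the support of \<open>D0\<close> below
  it, a proper extension.\<close>

lemma Res_max_enabled:
  assumes max: "Z \<in> Res_max N x" and z0: "z0 \<in> states G" and en: "enabled N (corr Z z0)"
  shows "enabled G z0"
proof (rule ccontr)
  assume dead: "\<not> enabled G z0"
  obtain a0 D0 where t0: "(corr Z z0, a0, D0) \<in> transitions N" using en by (auto simp: enabled_def)
  \<comment> \<open>Old states move to the even numbers, the odd ones provide fresh states.\<close>
  define f :: "nat \<Rightarrow> nat" where "f n = 2 * n" for n
  define h where "h s = Suc (2 * to_nat_on (states N) s)" for s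
  \<comment> \<open>\<open>corr\<close> halves its argument: an even number gives back the old
    state, an odd one the index of a state of \<open>N\<close>. Hence \<open>h s\<close> is a copy
    of \<open>s\<close>.\<close>
  define Z' where "Z' = \<lparr> graph = \<lparr> states = f ` states G \<union> h ` set_pmf D0, actions = actions G,
      transitions = insert (f z0, a0, map_pmf h D0) ((\<lambda>(z, a, D). (f z, a, map_pmf f D)) ` transitions G) \<rparr>,
    root = f (root Z),
    corr = (\<lambda>n. if even n then corr Z (n div 2) else from_nat_into (states N) (n div 2)) \<rparr>"
  have cN: "countable (states N)" using nplts_N by (simp add: nplts_def)
  have D0: "set_pmf D0 \<subseteq> states N" using nplts_transD[OF nplts_N t0] by simp
  have [simp]: "f m = f n \<longleftrightarrow> m = n" "f m \<noteq> h s" "h s \<noteq> f m" for m n s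
    by (simp_all add: f_def h_def) presburger+
  have corrf [simp]: "corr Z' (f n) = corr Z n" for n by (simp add: Z'_def f_def)
  have corrh: "corr Z' (h s) = s" if "s \<in> set_pmf D0" for s
    using that D0 cN by (auto simp: Z'_def h_def)
  have hinj: "inj_on h (set_pmf D0)" using corrh by (metis inj_onI)
  have graph': "states (graph Z') = f ` states G \<union> h ` set_pmf D0" "actions (graph Z') = actions G"
    "root Z' = f (root Z)" by (simp_all add: Z'_def)
  have trans': "(z', a, D') \<in> transitions (graph Z') \<longleftrightarrow>
      (z' = f z0 \<and> a = a0 \<and> D' = map_pmf h D0) \<or>
      (\<exists>z D. (z, a, D) \<in> transitions G \<and> z' = f z \<and> D' = map_pmf f D)" for z' a D'
    by (force simp: Z'_def)
  have nG': "nplts (graph Z')"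
  proof -
    have "z \<in> states (graph Z') \<and> a \<in> actions (graph Z') \<and> set_pmf D \<subseteq> states (graph Z')"
      if "(z, a, D) \<in> transitions (graph Z')" for z a D
      using that unfolding trans'
    proof (elim disjE exE conjE)
      assume "z = f z0" "a = a0" "D = map_pmf h D0"
      then show ?thesis using nplts_transD(2)[OF nplts_N t0] z0 by (auto simp: graph' actions_G)
    next
      fix y E assume t: "(y, a, E) \<in> transitions G" and "z = f y" "D = map_pmf f E"
      then show ?thesis using nplts_transD[OF nplts_G t] by (auto simp: graph')
    qed
    then show ?thesis using nplts_G unfolding nplts_def graph'(2) by auto
  qed
  have comp': "computation G z c \<Longrightarrow> computation (graph Z') (f z) (map (map_prod id f) c) \<and>
      last_state (f z) (map (map_prod id f) c) = f (last_state z c)" for z c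
  proof (induction c arbitrary: z)
    case Nil
    then show ?case by (simp add: graph')
  next
    case (Cons p c)
    obtain a y where p: "p = (a, y)" by (cases p)
    then obtain D where "(z, a, D) \<in> transitions G" "y \<in> set_pmf D" using Cons.prems by auto
    then have "(f z, a, map_pmf f D) \<in> transitions (graph Z')" "f y \<in> set_pmf (map_pmf f D)"
      by (auto simp: trans')
    then show ?case using Cons p by auto
  qed
  have "resolution_of N x Z'"
  proof (rule resolution_ofI)
    show "nplts (graph Z')" by (rule nG')
    show "actions (graph Z') = actions N" by (simp add: graph' actions_G)
    show "root Z' \<in> states (graph Z')" by (simp add: graph' root_state)
    show "corr Z' (root Z') = x" by (simp add: graph' corr_root)
    show "corr Z' ` states (graph Z') \<subseteq> states N"
      using corr_state corrh D0 by (auto simp: graph')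
    show "\<exists>c. computation (graph Z') (root Z') c \<and> last_state (root Z') c = z"
      if "z \<in> states (graph Z')" for z
    proof -
      have old: "\<exists>c. computation (graph Z') (root Z') c \<and> last_state (root Z') c = f y"
        if "y \<in> states G" for y
        using reachable[OF that] comp'[of "root Z"] unfolding graph'(3) by metis
      from that consider y where "y \<in> states G" "z = f y" | s where "s \<in> set_pmf D0" "z = h s"
        by (auto simp: graph')
      then show ?thesis
      proof cases
        case 1
        then show ?thesis using old by simp
      next
        case 2
        obtain c where "computation (graph Z') (root Z') c" "last_state (root Z') c = f z0"
          using old z0 by blast
        then have "computation (graph Z') (root Z') (c @ [(a0, z)])"
          using 2 by (force simp: computation_snoc[OF nG'] trans')
        then show ?thesis by (metis last_state_snoc)
      qed
    qed
    show "root Z' \<notin> set_pmf D" if "(z, a, D) \<in> transitions (graph Z')" for z a D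
      using that unfolding trans' graph'(3) by (auto simp: root_not_in_support)
    show "z = z' \<and> a = a'"
      if "(z, a, D) \<in> transitions (graph Z')" "(z', a', D') \<in> transitions (graph Z')"
        "y \<in> set_pmf D" "y \<in> set_pmf D'" for z a D z' a' D' y
      using that unfolding trans' by auto (metis pred_unique)+
    show "(corr Z' z, a, map_pmf (corr Z') D) \<in> transitions N \<and> inj_on (corr Z') (set_pmf D)"
      if "(z, a, D) \<in> transitions (graph Z')" for z a D
    proof -
      consider "z = f z0" "a = a0" "D = map_pmf h D0"
        | y E where "(y, a, E) \<in> transitions G" "z = f y" "D = map_pmf f E"
        using \<open>(z, a, D) \<in> transitions (graph Z')\<close> unfolding trans' by blast
      then show ?thesis
      proof cases
        case 1
        have "map_pmf (corr Z') D = D0"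
          using corrh by (simp add: 1 map_pmf_comp cong: map_pmf_cong)
        moreover have "inj_on (corr Z') (set_pmf D)"
          using corrh by (auto simp: 1 inj_on_def)
        ultimately show ?thesis using t0 1 by simp
      next
        case 2
        then show ?thesis using corr_trans[OF 2(1)] by (auto simp: map_pmf_comp inj_on_def)
      qed
    qed
    \<comment> \<open>The new transition leaves the copy of \<open>z0\<close>, which is dead in
      \<open>Z\<close>, so it competes with no old one.\<close>
    show "a1 = a2 \<and> D1 = D2"
      if "(z, a1, D1) \<in> transitions (graph Z')" "(z, a2, D2) \<in> transitions (graph Z')" for z a1 D1 a2 D2
      using that dead unfolding trans' enabled_def by auto (metis trans_unique)+
  qed
  moreover have "proper_extension Z Z'"
  proof -
    have "embeds f Z Z'"
      unfolding embeds_def by (force simp: graph' trans' inj_on_def)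
    moreover obtain s where "s \<in> set_pmf D0" using set_pmf_not_empty by fast
    then have "h s \<in> states (graph Z')" "h s \<notin> f ` states G" by (auto simp: graph')
    ultimately show ?thesis unfolding proper_extension_def by blast
  qed
  ultimately show False using max by (auto simp: Res_max_def Res_def)
qed

end

section \<open>Resolutions induced by schedulers\<close>

text \<open>A deterministic choice that may depend on the whole history. Stopping is allowed only
  where nothing is enabled, which makes the induced resolution maximal.\<close>

definition scheduler :: "('s, 'a) nplts \<Rightarrow> 's \<Rightarrow> (('s, 'a) comp \<Rightarrow> ('a \<times> 's pmf) option) \<Rightarrow> bool" where
  "scheduler N x \<sigma> \<longleftrightarrow> (\<forall>h. computation N x h \<longrightarrow>
     (case \<sigma> h of None \<Rightarrow> \<not> enabled N (last_state x h)
      | Some t \<Rightarrow> (last_state x h, t) \<in> transitions N))"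

text \<open>Where nothing is prescribed, any enabled transition may be picked. Thus only the
  relevant part of a scheduler has to be written down.\<close>

lemma scheduler_extending:
  assumes "\<And>h t. computation N x h \<Longrightarrow> \<rho> h = Some t \<Longrightarrow> (last_state x h, t) \<in> transitions N"
  obtains \<sigma> where "scheduler N x \<sigma>" "\<And>h t. \<rho> h = Some t \<Longrightarrow> \<sigma> h = Some t"
proof
  define \<sigma> where "\<sigma> h = (case \<rho> h of Some t \<Rightarrow> Some t
    | None \<Rightarrow> if enabled N (last_state x h) then Some (SOME t. (last_state x h, t) \<in> transitions N) else None)" for h
  have "(s, SOME t. (s, t) \<in> transitions N) \<in> transitions N" if "enabled N s" for s
    using that unfolding enabled_def by (metis someI_ex)
  then show "scheduler N x \<sigma>"
    using assms by (auto simp: scheduler_def \<sigma>_def split: option.split)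
  show "\<And>h t. \<rho> h = Some t \<Longrightarrow> \<sigma> h = Some t" by (simp add: \<sigma>_def)
qed

text \<open>The computations that arise from following \<sigma>; they become the states of the
  induced resolution.\<close>

inductive_set histories :: "'s \<Rightarrow> (('s, 'a) comp \<Rightarrow> ('a \<times> 's pmf) option) \<Rightarrow> ('s, 'a) comp set"
  for x \<sigma> where
  Nil: "[] \<in> histories x \<sigma>"
| snoc: "h \<in> histories x \<sigma> \<Longrightarrow> \<sigma> h = Some (a, D) \<Longrightarrow> s' \<in> set_pmf D \<Longrightarrow> h @ [(a, s')] \<in> histories x \<sigma>"

lemma countable_computations:
  assumes "nplts N"
  shows "countable {c. computation N x c}"
proof (rule countable_subset)
  have "computation N x c \<Longrightarrow> c \<in> lists (actions N \<times> states N)" for c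
    using assms
  proof (induction N x c rule: computation.induct)
    case (2 N s a s' c)
    then show ?case by (auto dest: nplts_transD intro: computation_start)
  qed simp
  then show "{c. computation N x c} \<subseteq> lists (actions N \<times> states N)" by blast
  show "countable (lists (actions N \<times> states N))" using assms by (auto simp: nplts_def)
qed

text \<open>With whole histories as states the graph is automatically a tree, since a nonempty
  history determines its last step and its predecessor. Countability of the computations allows
  coding them as natural numbers. The second conclusion is what lets later proofs steer
  \<open>Z\<close> through \<sigma>.\<close>

lemma scheduled_resolution:
  fixes N :: "('s, 'a) nplts"
  assumes N: "nplts N" and x: "x \<in> states N" and sched: "scheduler N x \<sigma>"
  obtains Z where "Z \<in> Res_max N x"
    "\<And>c a D. computation (graph Z) (root Z) c \<Longrightarrow> (last_state (root Z) c, a, D) \<in> transitions (graph Z) \<Longrightarrow>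
      \<sigma> (corr_comp Z c) = Some (a, map_pmf (corr Z) D)"
proof -
  define P where "P = histories x \<sigma>"
  define C where "C = {c. computation N x c}"
  define enc where "enc = to_nat_on C"
  define dec where "dec = from_nat_into C"
  have PC: "h \<in> P \<Longrightarrow> computation N x h" for h
    unfolding P_def
  proof (induction rule: histories.induct)
    case (snoc h a D s')
    then have "(last_state x h, a, D) \<in> transitions N" using sched by (fastforce simp: scheduler_def)
    then show ?case using snoc by (auto simp: computation_snoc[OF N])
  qed (use x in simp)
  have \<sigma>: "(last_state x h, a, D) \<in> transitions N" if "h \<in> P" "\<sigma> h = Some (a, D)" for h a D
    using sched PC[OF that(1)] that(2) by (fastforce simp: scheduler_def)
  have Psnoc: "h @ [(a, s')] \<in> P" if "h \<in> P" "\<sigma> h = Some (a, D)" "s' \<in> set_pmf D" for h a D s'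
    using that unfolding P_def by (rule histories.snoc)
  have dec [simp]: "dec (enc h) = h" if "h \<in> P" for h
    using PC[OF that] countable_computations[OF N] by (simp add: dec_def enc_def C_def)
  have enc_eq: "enc h = enc h' \<longleftrightarrow> h = h'" if "h \<in> P" "h' \<in> P" for h h'
    using dec that by metis
  \<comment> \<open>\<open>ext h a\<close> sends a target state to the code of the prolonged
    history. On the support \<open>corr Z\<close> inverts it, so the push-forward along it projects
    back to \<open>D\<close>.\<close>
  define ext where "ext h a s' = enc (h @ [(a, s')])" for h a s'
  define Z where "Z = \<lparr> graph = \<lparr> states = enc ` P, actions = actions N,
      transitions = {(enc h, a, map_pmf (ext h a) D) | h a D. h \<in> P \<and> \<sigma> h = Some (a, D)} \<rparr>,
    root = enc [], corr = (\<lambda>n. last_state x (dec n)) \<rparr>"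
  have graph: "states (graph Z) = enc ` P" "actions (graph Z) = actions N" "root Z = enc []"
    by (simp_all add: Z_def)
  have trans: "(z, a, D') \<in> transitions (graph Z) \<longleftrightarrow>
      (\<exists>h D. h \<in> P \<and> \<sigma> h = Some (a, D) \<and> z = enc h \<and> D' = map_pmf (ext h a) D)" for z a D'
    by (auto simp: Z_def)
  have corr: "corr Z (enc h) = last_state x h" if "h \<in> P" for h
    using that by (simp add: Z_def)
  have NilP: "[] \<in> P" unfolding P_def by (rule histories.Nil)
  have corr_ext: "corr Z (ext h a s') = s'" if "h \<in> P" "\<sigma> h = Some (a, D)" "s' \<in> set_pmf D" for h a D s'
    using corr[OF Psnoc[OF that]] by (simp add: ext_def)
  have nZ: "nplts (graph Z)"
  proof -
    have "z \<in> states (graph Z) \<and> a \<in> actions (graph Z) \<and> set_pmf D' \<subseteq> states (graph Z)"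
      if t: "(z, a, D') \<in> transitions (graph Z)" for z a D'
    proof -
      obtain h D where h: "h \<in> P" "\<sigma> h = Some (a, D)" "z = enc h" "D' = map_pmf (ext h a) D"
        using t unfolding trans by blast
      then show ?thesis using Psnoc nplts_transD(2)[OF N \<sigma>[OF h(1,2)]]
        by (auto simp: graph ext_def)
    qed
    then show ?thesis using N unfolding nplts_def graph(2) by auto
  qed
  have reach: "\<exists>c. computation (graph Z) (root Z) c \<and> last_state (root Z) c = enc h" if "h \<in> P" for h
    using that unfolding P_def
  proof (induction rule: histories.induct)
    case Nil
    show ?case by (rule exI[of _ "[]"]) (simp add: graph NilP)
  next
    case (snoc h a D s')
    then obtain c where c: "computation (graph Z) (root Z) c" "last_state (root Z) c = enc h" by blast
    have "(enc h, a, map_pmf (ext h a) D) \<in> transitions (graph Z)"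
      unfolding trans using snoc by (auto simp: P_def)
    then have "computation (graph Z) (root Z) (c @ [(a, ext h a s')])"
      using c snoc by (auto simp: computation_snoc[OF nZ])
    then show ?case by (metis last_state_snoc ext_def)
  qed
  have "resolution_of N x Z"
  proof (rule resolution_ofI)
    show "corr Z ` states (graph Z) \<subseteq> states N"
      using computation_last[OF PC] by (auto simp: graph corr)
    show "root Z \<notin> set_pmf D" if t: "(z, a, D) \<in> transitions (graph Z)" for z a D
    proof
      assume r: "root Z \<in> set_pmf D"
      obtain h E where h: "h \<in> P" "\<sigma> h = Some (a, E)" "D = map_pmf (ext h a) E"
        using t unfolding trans by blast
      then obtain u where "u \<in> set_pmf E" "enc [] = ext h a u" using r by (auto simp: graph)
      then show False using enc_eq[OF NilP Psnoc[OF h(1,2)]] by (simp add: ext_def)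
    qed
    show "z = z' \<and> a = a'"
      if t: "(z, a, D) \<in> transitions (graph Z)" "(z', a', D') \<in> transitions (graph Z)"
        and y: "y \<in> set_pmf D" "y \<in> set_pmf D'" for z a D z' a' D' y
    proof -
      obtain h E where h: "h \<in> P" "\<sigma> h = Some (a, E)" "z = enc h" "D = map_pmf (ext h a) E"
        using t(1) unfolding trans by blast
      obtain h' E' where h': "h' \<in> P" "\<sigma> h' = Some (a', E')" "z' = enc h'" "D' = map_pmf (ext h' a') E'"
        using t(2) unfolding trans by blast
      obtain u u' where "u \<in> set_pmf E" "u' \<in> set_pmf E'" "ext h a u = ext h' a' u'"
        using y h(4) h'(4) by auto
      then have "h @ [(a, u)] = h' @ [(a', u')]"
        using enc_eq[OF Psnoc[OF h(1,2)] Psnoc[OF h'(1,2)]] by (simp add: ext_def)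
      then show ?thesis using h h' by simp
    qed
    show "(corr Z z, a, map_pmf (corr Z) D) \<in> transitions N \<and> inj_on (corr Z) (set_pmf D)"
      if t: "(z, a, D) \<in> transitions (graph Z)" for z a D
    proof -
      obtain h E where h: "h \<in> P" "\<sigma> h = Some (a, E)" "z = enc h" "D = map_pmf (ext h a) E"
        using t unfolding trans by blast
      have "map_pmf (corr Z) D = E"
        using corr_ext[OF h(1,2)] by (simp add: h(4) map_pmf_comp cong: map_pmf_cong)
      moreover have "inj_on (corr Z) (set_pmf D)"
        using corr_ext[OF h(1,2)] by (auto simp: h(4) inj_on_def)
      ultimately show ?thesis using \<sigma>[OF h(1,2)] h corr by simp
    qed
    show "a1 = a2 \<and> D1 = D2"
      if "(z, a1, D1) \<in> transitions (graph Z)" "(z, a2, D2) \<in> transitions (graph Z)" for z a1 D1 a2 D2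
      using that unfolding trans by (auto simp: enc_eq)
  qed (use nZ reach corr NilP in \<open>auto simp: graph\<close>)
  then interpret R: resolution N x Z using N by unfold_locales
  have max: "Z \<in> Res_max N x"
  proof (rule R.Res_maxI)
    fix z assume "z \<in> states (graph Z)" and en: "enabled N (corr Z z)"
    then obtain h where h: "h \<in> P" "z = enc h" by (auto simp: graph)
    then obtain a D where "\<sigma> h = Some (a, D)"
      using sched PC[OF h(1)] en corr[OF h(1)] by (fastforce simp: scheduler_def split: option.splits)
    then show "enabled (graph Z) z" using h unfolding enabled_def trans by blast
  qed
  \<comment> \<open>Invariant: the state reached by \<open>c\<close> is the code of the history onto
    which \<open>c\<close> projects, so the transition taken there is the one \<sigma> assigns to
    \<open>corr_comp Z c\<close>.\<close>
  have run: "computation (graph Z) (root Z) c \<Longrightarrow> corr_comp Z c \<in> P \<and> last_state (root Z) c = enc (corr_comp Z c)" for c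
  proof (induction c rule: rev_induct)
    case Nil
    then show ?case by (simp add: NilP graph )
  next
    case (snoc p c)
    obtain a y where p: "p = (a, y)" by (cases p)
    obtain D where D: "computation (graph Z) (root Z) c"
      "(last_state (root Z) c, a, D) \<in> transitions (graph Z)" "y \<in> set_pmf D"
      using snoc.prems by (auto simp: computation_snoc[OF nZ] p)
    have IH: "corr_comp Z c \<in> P" "last_state (root Z) c = enc (corr_comp Z c)" using snoc.IH D(1) by auto
    then obtain E where E: "\<sigma> (corr_comp Z c) = Some (a, E)" "D = map_pmf (ext (corr_comp Z c) a) E"
      using D(2) unfolding trans by (auto simp: enc_eq)
    then obtain s' where s': "s' \<in> set_pmf E" "y = ext (corr_comp Z c) a s'" using D(3) by auto
    have "corr Z y = s'" using corr_ext[OF IH(1) E(1) s'(1)] s' by simp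
    then show ?case using Psnoc[OF IH(1) E(1) s'(1)] s' p by (simp add: ext_def)
  qed
  show ?thesis
  proof (rule that[OF max])
    fix c a D
    assume c: "computation (graph Z) (root Z) c" and t: "(last_state (root Z) c, a, D) \<in> transitions (graph Z)"
    have IH: "corr_comp Z c \<in> P" "last_state (root Z) c = enc (corr_comp Z c)" using run[OF c] by auto
    then obtain E where E: "\<sigma> (corr_comp Z c) = Some (a, E)" "D = map_pmf (ext (corr_comp Z c) a) E"
      using t unfolding trans by (auto simp: enc_eq)
    have "map_pmf (corr Z) D = E"
      using corr_ext[OF IH(1) E(1)] by (simp add: E(2) map_pmf_comp cong: map_pmf_cong)
    with E show "\<sigma> (corr_comp Z c) = Some (a, map_pmf (corr Z) D)" by simp
  qed
qed

text \<open>Keeps the suprema and infima of success probabilities from ranging over an empty set; a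
  scheduler with nothing prescribed suffices.\<close>

lemma Res_max_nonempty:
  assumes "nplts N" "x \<in> states N"
  shows "Res_max N x \<noteq> {}"
proof -
  obtain \<sigma> where \<sigma>: "scheduler N x \<sigma>" by (rule scheduler_extending[of N x "\<lambda>_. None"]) auto
  obtain Z where "Z \<in> Res_max N x" by (rule scheduled_resolution[OF assms \<sigma>])
  then show ?thesis by auto
qed

section \<open>Success probabilities in the fully probabilistic and nondeterministic cases\<close>

lemma resolution_Res_max: "nplts N \<Longrightarrow> Z \<in> Res_max N x \<Longrightarrow> resolution N x Z"
  by unfold_locales (auto simp: Res_max_def Res_def)

lemma fully_probabilistic_imp_reactive: "fully_probabilistic N \<Longrightarrow> reactive_probabilistic N"
  unfolding fully_probabilistic_def reactive_probabilistic_def by metis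

section \<open>Interaction systems inherit the class of the process and the test\<close>

lemma trans_interaction:
  "((s, q), a, D) \<in> transitions (interaction L T) \<longleftrightarrow>
    (\<exists>D1 D2. D = pair_pmf D1 D2 \<and> (s, a, D1) \<in> transitions L \<and> (q, a, D2) \<in> transitions T)"
  by (auto simp: interaction_def)

lemma states_interaction: "states (interaction L T) = states L \<times> states T"
  by (simp add: interaction_def)

lemma nplts_interaction:
  assumes "nplts L" "nplts T"
  shows "nplts (interaction L T)"
  using assms unfolding nplts_def by (fastforce simp: interaction_def)

lemma fully_probabilistic_interaction:
  assumes "fully_probabilistic L" "fully_probabilistic T"
  shows "fully_probabilistic (interaction L T)"
  using assms unfolding fully_probabilistic_def split_paired_all split_paired_All trans_interaction by metis

lemma reactive_probabilistic_interaction: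
  assumes "reactive_probabilistic L" "reactive_probabilistic T"
  shows "reactive_probabilistic (interaction L T)"
  using assms unfolding reactive_probabilistic_def split_paired_all split_paired_All trans_interaction by metis

lemma fully_nondeterministic_interaction:
  assumes "fully_nondeterministic L" "fully_nondeterministic T"
  shows "fully_nondeterministic (interaction L T)"
  using assms unfolding fully_nondeterministic_def
  by (fastforce simp: interaction_def pair_return_pmf1)

section \<open>Fully probabilistic systems: resolutions reproduce all computations\<close>

context resolution
begin

lemma prob_of_cmap:
  assumes "reactive_probabilistic N" "C \<subseteq> {c. computation G z c}"
  shows "prob_of N (corr Z z) (cmap ` C) = prob_of G z C"
proof -
  have "prob_of N (corr Z z) (cmap ` C) = infsum (comp_prob N (corr Z z) \<circ> cmap) C"
    unfolding prob_of_def by (rule infsum_reindex) (use inj_on_cmap assms(2) in \<open>rule inj_on_subset\<close>)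
  also have "\<dots> = prob_of G z C"
    unfolding prob_of_def by (rule infsum_cong) (use assms in \<open>auto simp: comp_prob_cmap\<close>)
  finally show ?thesis .
qed

text \<open>Maximality makes the resolution move whenever \<open>N\<close> does, and full
  probabilism leaves it only the transition that \<open>N\<close> has; so every step of
  \<open>N\<close> has a preimage in the support.\<close>

lemma computation_lift:
  assumes max: "Z \<in> Res_max N x" and fp: "fully_probabilistic N"
  shows "z \<in> states G \<Longrightarrow> computation N (corr Z z) c \<Longrightarrow> \<exists>c'. computation G z c' \<and> cmap c' = c"
proof (induction c arbitrary: z)
  case Nil
  then show ?case by (intro exI[of _ "[]"]) simp
next
  case (Cons p c)
  obtain a s' where p: "p = (a, s')" by (cases p)
  obtain D where D: "(corr Z z, a, D) \<in> transitions N" "s' \<in> set_pmf D" "computation N s' c"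
    using Cons.prems p by auto
  then have "enabled N (corr Z z)" by (auto simp: enabled_def)
  then have "enabled G z" by (rule Res_max_enabled[OF max Cons.prems(1)])
  then obtain b E where E: "(z, b, E) \<in> transitions G" by (auto simp: enabled_def)
  have "b = a" "map_pmf (corr Z) E = D"
    using fp corr_trans(1)[OF E] D(1) unfolding fully_probabilistic_def by metis+
  then obtain z' where z': "z' \<in> set_pmf E" "corr Z z' = s'" using D(2) by auto
  then have "z' \<in> states G" using nplts_transD(3)[OF nplts_G E] by auto
  then obtain c' where "computation G z' c'" "cmap c' = c" using Cons.IH z' D(3) by metis
  then show ?case using E z' \<open>b = a\<close> p by (intro exI[of _ "(a, z') # c'"]) auto
qed

end

lemma success_prob_fully_probabilistic:
  assumes N: "nplts N" and fp: "fully_probabilistic N" and Z: "Z \<in> Res_max N x"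
  shows "success_prob w Z = prob_of N x (SC N w x)"
proof -
  interpret R: resolution N x Z by (rule resolution_Res_max[OF N Z])
  \<comment> \<open>Projection keeps the final configuration and hence success. That every
    successful computation of \<open>N\<close> is hit is where maximality of \<open>Z\<close>
    enters.\<close>
  have "R.cmap ` SC_res w Z = SC N w x"
  proof (intro subset_antisym subsetI)
    fix c assume "c \<in> R.cmap ` SC_res w Z"
    then show "c \<in> SC N w x"
      using R.computation_cmap[of "root Z"] R.corr_last_state[of "root Z"] R.corr_root
      by (auto simp: SC_res_def SC_def)
  next
    fix c assume c: "c \<in> SC N w x"
    then obtain c' where "computation R.G (root Z) c'" "R.cmap c' = c"
      using R.computation_lift[OF Z fp R.root_state] R.corr_root by (auto simp: SC_def)
    then show "c \<in> R.cmap ` SC_res w Z"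
      using c R.corr_last_state[of "root Z"] R.corr_root by (auto simp: SC_res_def SC_def)
  qed
  moreover have "SC_res w Z \<subseteq> {c. computation R.G (root Z) c}" by (auto simp: SC_res_def)
  ultimately show ?thesis
    using R.prob_of_cmap[OF fully_probabilistic_imp_reactive[OF fp]] R.corr_root
    by (metis success_prob_def)
qed

section \<open>Fully nondeterministic systems: resolutions are paths\<close>

context resolution
begin

text \<open>Every step of the resolution projects to a step of \<open>N\<close>, so following
  transitions must stop by well-foundedness; hence the induction on \<open>corr Z z\<close>.\<close>

lemma maximal_run:
  assumes wf: "wf ((step_relation N)\<inverse>)"
  shows "z \<in> states G \<Longrightarrow> \<exists>c. computation G z c \<and> \<not> enabled G (last_state z c)"
proof (induction "corr Z z" arbitrary: z rule: wf_induct_rule[OF wf])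
  case (1 z)
  show ?case
  proof (cases "enabled G z")
    case True
    then obtain a D z' where D: "(z, a, D) \<in> transitions G" "z' \<in> set_pmf D"
      using set_pmf_not_empty unfolding enabled_def by fast
    have "(corr Z z', corr Z z) \<in> (step_relation N)\<inverse>"
      using corr_trans(1)[OF D(1)] D(2) by (force simp: step_relation_def)
    moreover have "z' \<in> states G" using nplts_transD(3)[OF nplts_G D(1)] D(2) by auto
    ultimately obtain c where "computation G z' c" "\<not> enabled G (last_state z' c)"
      using 1(1) by metis
    then show ?thesis using D by (intro exI[of _ "(a, z') # c"]) auto
  next
    case False
    then show ?thesis using 1 by (intro exI[of _ "[]"]) simp
  qed
qed

text \<open>\<open>corr Z\<close> is injective on the support and maps it to a single point, so the
  support is a single point.\<close>

lemma trans_deterministic: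
  assumes "fully_nondeterministic N" "(z, a, D) \<in> transitions G" "z' \<in> set_pmf D"
  shows "D = return_pmf z'"
proof -
  obtain s where s: "map_pmf (corr Z) D = return_pmf s"
    using assms(1) corr_trans(1)[OF assms(2)] unfolding fully_nondeterministic_def by fastforce
  then have "corr Z ` set_pmf D = {s}" by (metis set_map_pmf set_return_pmf)
  then have "set_pmf D = {z'}"
    using corr_trans(2)[OF assms(2)] assms(3) by (auto simp: inj_on_def) (metis imageI singletonD)
  then show ?thesis by (intro set_pmf_subset_singleton[THEN iffD1]) simp
qed

lemma comp_prob_deterministic:
  assumes "fully_nondeterministic N"
  shows "computation G z c \<Longrightarrow> comp_prob G z c = 1"
proof (induction c arbitrary: z)
  case (Cons p c)
  obtain a z' where p: "p = (a, z')" by (cases p)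
  then obtain D where D: "(z, a, D) \<in> transitions G" "z' \<in> set_pmf D" using Cons.prems by auto
  then have "D = return_pmf z'" by (rule trans_deterministic[OF assms])
  then show ?case using Cons p the_trans[OF D(1)] by simp
qed simp

text \<open>With one transition per state and one target per transition the resolution never
  branches.\<close>

lemma maximal_run_unique:
  assumes "fully_nondeterministic N"
  shows "computation G z c \<Longrightarrow> \<not> enabled G (last_state z c) \<Longrightarrow>
    computation G z d \<Longrightarrow> \<not> enabled G (last_state z d) \<Longrightarrow> c = d"
proof (induction c arbitrary: z d)
  case Nil
  then show ?case by (cases d) (auto simp: enabled_def)
next
  case (Cons p c)
  obtain a z' where p: "p = (a, z')" by (cases p)
  then obtain D where D: "(z, a, D) \<in> transitions G" "z' \<in> set_pmf D" using Cons.prems by auto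
  then obtain a2 z2 e where d: "d = (a2, z2) # e" using Cons.prems by (cases d) (auto simp: enabled_def)
  then obtain D2 where D2: "(z, a2, D2) \<in> transitions G" "z2 \<in> set_pmf D2" using Cons.prems by auto
  have "a2 = a" "D2 = D" using trans_unique D D2 by metis+
  then have "z2 = z'" using D D2 trans_deterministic[OF assms] by fastforce
  then show ?case using Cons p d \<open>a2 = a\<close> by auto
qed

end

text \<open>The resolution is a single path, and \<open>c\<close> is its maximal run. A success
  state allows no further step, so a successful computation can only be \<open>c\<close>, which has
  probability 1.\<close>

lemma success_prob_nondeterministic:
  assumes N: "nplts N" and fnd: "fully_nondeterministic N" and wf: "wf ((step_relation N)\<inverse>)"
    and w: "\<And>s. \<not> enabled N (s, w)" and Z: "Z \<in> Res_max N x"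
  obtains c where "computation (graph Z) (root Z) c"
    "maximal_computation N x (corr_comp Z c)"
    "success_prob w Z = (if corr_comp Z c \<in> SC N w x then 1 else 0)"
proof -
  interpret R: resolution N x Z by (rule resolution_Res_max[OF N Z])
  obtain c where c: "computation R.G (root Z) c" "\<not> enabled R.G (last_state (root Z) c)"
    using R.maximal_run[OF wf R.root_state] by auto
  have last: "corr Z (last_state (root Z) d) = last_state x (R.cmap d)" for d
    using R.corr_last_state R.corr_root by metis
  have comp: "computation N x (R.cmap d)" if "computation R.G (root Z) d" for d
    using R.computation_cmap[OF that] R.corr_root by simp
  \<comment> \<open>A maximal resolution stops only where \<open>N\<close> does, so the projection
    of its maximal run is maximal in \<open>N\<close>.\<close>
  have "\<not> enabled N (corr Z (last_state (root Z) c))"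
    using c R.Res_max_enabled[OF Z] computation_last by metis
  then have max: "maximal_computation N x (R.cmap c)"
    using comp[OF c(1)] last by (simp add: maximal_computation_iff[OF N] enabled_def)
  have "d = c" if dS: "d \<in> SC_res w Z" for d
  proof (rule R.maximal_run_unique[OF fnd _ _ c])
    show d: "computation R.G (root Z) d" using that by (simp add: SC_res_def)
    obtain s where "corr Z (last_state (root Z) d) = (s, w)"
      using dS unfolding SC_res_def by (metis (mono_tags, lifting) mem_Collect_eq prod.collapse)
    then have "\<not> enabled N (corr Z (last_state (root Z) d))" using w by simp
    then show "\<not> enabled R.G (last_state (root Z) d)"
      using R.corr_trans(1) unfolding enabled_def by metis
  qed
  then have sub: "SC_res w Z \<subseteq> {c}" by auto
  have mem: "c \<in> SC_res w Z \<longleftrightarrow> R.cmap c \<in> SC N w x"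
    using c(1) comp[OF c(1)] by (simp add: SC_res_def SC_def last)
  have "success_prob w Z = (if R.cmap c \<in> SC N w x then 1 else 0)"
  proof (cases "R.cmap c \<in> SC N w x")
    case True
    then have "SC_res w Z = {c}" using sub mem by auto
    then show ?thesis using True R.comp_prob_deterministic[OF fnd c(1)]
      by (simp add: success_prob_def prob_of_def)
  next
    case False
    then have "SC_res w Z = {}" using sub mem by auto
    then show ?thesis using False by (simp add: success_prob_def prob_of_def)
  qed
  with c(1) max show ?thesis by (rule that)
qed

text \<open>The scheduler replays \<open>c\<close>, so all runs of the induced resolution project to
  prefixes of \<open>c\<close>. The maximal run projects to a maximal computation, which can be no
  strict prefix.\<close>

lemma maximal_computation_scheduled:
  assumes N: "nplts N" and fnd: "fully_nondeterministic N" and wf: "wf ((step_relation N)\<inverse>)"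
    and w: "\<And>s. \<not> enabled N (s, w)" and x: "x \<in> states N" and c: "maximal_computation N x c"
  obtains Z where "Z \<in> Res_max N x" "success_prob w Z = (if c \<in> SC N w x then 1 else 0)"
proof -
  have cc: "computation N x c" and cdead: "\<not> enabled N (last_state x c)"
    using c by (auto simp: maximal_computation_iff[OF N] enabled_def)
  \<comment> \<open>After a strict prefix \<open>h\<close> of \<open>c\<close>, the entry at index
    \<open>length h\<close> is the next step; by full nondeterminism the point mass on its target is
    the distribution of an actual transition.\<close>
  define \<rho> where "\<rho> h = (if strict_prefix h c
    then Some (fst (c ! length h), return_pmf (snd (c ! length h))) else None)" for h
  have "(last_state x h, t) \<in> transitions N" if t: "\<rho> h = Some t" for h t
  proof -
    have "strict_prefix h c" using t by (auto simp: \<rho>_def split: if_splits)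
    then obtain a s' d where d: "c = h @ (a, s') # d" by (metis strict_prefixE' surj_pair)
    then have t: "t = (a, return_pmf s')" using t \<open>strict_prefix h c\<close> by (auto simp: \<rho>_def)
    obtain D where D: "(last_state x h, a, D) \<in> transitions N" "s' \<in> set_pmf D"
      using computation_append[of N x h "(a, s') # d"] cc d by auto
    then obtain s where "D = return_pmf s" using fnd unfolding fully_nondeterministic_def by fastforce
    then show ?thesis using D t by simp
  qed
  then obtain \<sigma> where \<sigma>: "scheduler N x \<sigma>" "\<And>h t. \<rho> h = Some t \<Longrightarrow> \<sigma> h = Some t"
    using scheduler_extending[of N x \<rho>] by metis
  obtain Z where Z: "Z \<in> Res_max N x" and
    Z\<sigma>: "\<And>c a D. computation (graph Z) (root Z) c \<Longrightarrow> (last_state (root Z) c, a, D) \<in> transitions (graph Z) \<Longrightarrow>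
      \<sigma> (corr_comp Z c) = Some (a, map_pmf (corr Z) D)"
    using scheduled_resolution[OF N x \<sigma>(1)] by metis
  interpret R: resolution N x Z by (rule resolution_Res_max[OF N Z])
  have pre: "computation R.G (root Z) d \<Longrightarrow> prefix (R.cmap d) c" for d
  proof (induction d rule: rev_induct)
    case (snoc p d)
    obtain a y where p: "p = (a, y)" by (cases p)
    obtain D where D: "computation R.G (root Z) d" "(last_state (root Z) d, a, D) \<in> transitions R.G" "y \<in> set_pmf D"
      using snoc.prems by (auto simp: computation_snoc[OF R.nplts_G] p)
    \<comment> \<open>\<open>c\<close> ends in a dead state, so a run that already projects to all
      of \<open>c\<close> cannot continue.\<close>
    have "R.cmap d \<noteq> c"
    proof
      assume "R.cmap d = c"
      then have "last_state x c = corr Z (last_state (root Z) d)"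
        using R.corr_last_state R.corr_root by metis
      then show False using cdead R.corr_trans(1)[OF D(2)] unfolding enabled_def by metis
    qed
    then have "strict_prefix (R.cmap d) c" using snoc.IH[OF D(1)] by (simp add: strict_prefix_def)
    then obtain q e where q: "c = R.cmap d @ q # e" by (metis strict_prefixE')
    have "\<rho> (R.cmap d) = Some (fst q, return_pmf (snd q))"
      using \<open>strict_prefix (R.cmap d) c\<close> by (simp add: \<rho>_def) (simp add: q nth_append)
    then have "a = fst q" "map_pmf (corr Z) D = return_pmf (snd q)"
      using Z\<sigma>[OF D(1,2)] \<sigma>(2) by fastforce+
    then have "corr Z y = snd q" using D(3) by (metis imageI set_map_pmf set_return_pmf singletonD)
    then have "R.cmap (d @ [p]) = R.cmap d @ [q]" using \<open>a = fst q\<close> p by simp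
    then show ?case by (simp add: q)
  qed simp
  obtain d where d: "computation R.G (root Z) d" "maximal_computation N x (R.cmap d)"
    "success_prob w Z = (if R.cmap d \<in> SC N w x then 1 else 0)"
    by (rule success_prob_nondeterministic[OF N fnd wf w Z])
  have "R.cmap d = c"
    using pre[OF d(1)] d(2) cc unfolding maximal_computation_def strict_prefix_def by metis
  then show ?thesis using d Z that by metis
qed

text \<open>Each step of the interaction is also a step of the test in the second component, and a
  finite acyclic test admits no infinite run.\<close>

lemma wf_interaction:
  assumes "npt A T w"
  shows "wf ((step_relation (interaction L T))\<inverse>)"
proof -
  have "step_relation T \<subseteq> states T \<times> states T" "finite (states T)" "acyclic (step_relation T)"
    using assms by (auto simp: npt_def step_relation_def dest: nplts_transD)
  then have "wf ((step_relation T)\<inverse>)"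
    by (meson finite_SigmaI finite_acyclic_wf_converse finite_subset)
  then have "wf (inv_image ((step_relation T)\<inverse>) (snd :: _ \<times> nat \<Rightarrow> nat))" by (rule wf_inv_image)
  then show ?thesis
    by (rule wf_subset) (auto simp: step_relation_def inv_image_def trans_interaction, blast)
qed

lemma not_enabled_success: "npt A T w \<Longrightarrow> \<not> enabled (interaction L T) (s, w)"
  by (auto simp: npt_def enabled_def trans_interaction)

lemma maximal_computation_SC:
  assumes "nplts N" "\<And>s. \<not> enabled N (s, w)" "c \<in> SC N w x"
  shows "maximal_computation N x c"
  using assms(2)[of "fst (last_state x c)"] assms(3)
  by (auto simp: SC_def maximal_computation_iff[OF assms(1)] enabled_def)

text \<open>Turns \<open>PTe_forall_exists\<close> into equality of the two sets of success
  probabilities.\<close>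

lemma forall_exists_iff_image_eq:
  "(\<forall>a \<in> A. \<exists>b \<in> B. f a = f b) \<and> (\<forall>b \<in> B. \<exists>a \<in> A. f b = f a) \<longleftrightarrow> f ` A = f ` B"
  by (auto simp: set_eq_iff image_iff)

lemma Sup_Inf_zero_one:
  fixes V :: "real set"
  assumes "V \<subseteq> {0, 1}" "V \<noteq> {}"
  shows "Sup V = of_bool (1 \<in> V)" "Inf V = of_bool (0 \<notin> V)"
proof -
  from assms have "V = {0} \<or> V = {1} \<or> V = {0, 1}" by auto
  then show "Sup V = of_bool (1 \<in> V)" "Inf V = of_bool (0 \<notin> V)"
    by (auto simp: cSup_eq_Max cInf_eq_Min)
qed

text \<open>The supremum records whether 1 is a member, the infimum whether 0 is absent, and these
  two bits determine a nonempty subset of \<open>{0, 1}\<close>. The first part serves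
  \<open>PTe_supinf\<close>, the second the two conditions of \<open>Te_fnd\<close>.\<close>

lemma Sup_Inf_zero_one_eq_iff:
  fixes V W :: "real set"
  assumes "V \<subseteq> {0, 1}" "V \<noteq> {}" "W \<subseteq> {0, 1}" "W \<noteq> {}"
  shows "Sup V = Sup W \<and> Inf V = Inf W \<longleftrightarrow> V = W"
    "(1 \<in> V \<longleftrightarrow> 1 \<in> W) \<and> (0 \<notin> V \<longleftrightarrow> 0 \<notin> W) \<longleftrightarrow> V = W"
proof -
  show "(1 \<in> V \<longleftrightarrow> 1 \<in> W) \<and> (0 \<notin> V \<longleftrightarrow> 0 \<notin> W) \<longleftrightarrow> V = W"
    using assms by auto
  then show "Sup V = Sup W \<and> Inf V = Inf W \<longleftrightarrow> V = W"
    using Sup_Inf_zero_one[OF assms(1,2)] Sup_Inf_zero_one[OF assms(3,4)]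
    by (simp split: if_splits) (metis of_bool_eq_iff)
qed

text \<open>Maximal resolutions and maximal computations realise each other, so \<open>V\<close> is
  the set of success indicators of the maximal computations: a 1 in it means possible success, the
  absence of 0 guaranteed success.\<close>

lemma success_probs_nondeterministic:
  assumes L: "nplts L" "fully_nondeterministic L" "s \<in> states L"
    and T: "npt (actions L) T w" "fully_nondeterministic T" "q \<in> states T"
  defines "N \<equiv> interaction L T"
  defines "V \<equiv> success_prob w ` Res_max N (s, q)"
  shows "V \<subseteq> {0, 1}" "V \<noteq> {}"
    "SC N w (s, q) \<noteq> {} \<longleftrightarrow> 1 \<in> V"
    "(\<forall>c. maximal_computation N (s, q) c \<longrightarrow> c \<in> SC N w (s, q)) \<longleftrightarrow> 0 \<notin> V"
proof -
  have nN: "nplts N" using L T by (auto simp: N_def npt_def nplts_interaction)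
  have fnd: "fully_nondeterministic N" using L T by (auto simp: N_def fully_nondeterministic_interaction)
  have wf: "wf ((step_relation N)\<inverse>)" unfolding N_def by (rule wf_interaction[OF T(1)])
  have w: "\<not> enabled N (s, w)" for s unfolding N_def by (rule not_enabled_success[OF T(1)])
  have x: "(s, q) \<in> states N" using L T by (simp add: N_def states_interaction)
  have V: "V = (\<lambda>c. if c \<in> SC N w (s, q) then 1 else 0) ` {c. maximal_computation N (s, q) c}"
  proof (intro subset_antisym subsetI)
    fix v assume "v \<in> V"
    then obtain Z where Z: "Z \<in> Res_max N (s, q)" "v = success_prob w Z" by (auto simp: V_def)
    obtain c where "maximal_computation N (s, q) (corr_comp Z c)"
      "success_prob w Z = (if corr_comp Z c \<in> SC N w (s, q) then 1 else 0)"
      by (rule success_prob_nondeterministic[OF nN fnd wf w Z(1)])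
    then show "v \<in> (\<lambda>c. if c \<in> SC N w (s, q) then 1 else 0) ` {c. maximal_computation N (s, q) c}"
      using Z(2) by blast
  next
    fix v assume "v \<in> (\<lambda>c. if c \<in> SC N w (s, q) then 1 else 0 :: real) ` {c. maximal_computation N (s, q) c}"
    then obtain c where c: "maximal_computation N (s, q) c" "v = (if c \<in> SC N w (s, q) then 1 else 0)"
      by blast
    obtain Z where "Z \<in> Res_max N (s, q)" "success_prob w Z = (if c \<in> SC N w (s, q) then 1 else 0)"
      by (rule maximal_computation_scheduled[OF nN fnd wf w x c(1)])
    then show "v \<in> V" using c(2) by (metis V_def imageI)
  qed
  show "V \<subseteq> {0, 1}" by (auto simp: V)
  show "V \<noteq> {}" unfolding V_def using Res_max_nonempty[OF nN x] by simp
  \<comment> \<open>A successful computation is maximal because success states are dead, so it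
    contributes a 1 to \<open>V\<close>.\<close>
  show "SC N w (s, q) \<noteq> {} \<longleftrightarrow> 1 \<in> V"
    using maximal_computation_SC[OF nN w] by (auto simp: V image_iff split: if_splits)
  show "(\<forall>c. maximal_computation N (s, q) c \<longrightarrow> c \<in> SC N w (s, q)) \<longleftrightarrow> 0 \<notin> V"
    by (auto simp: V image_iff split: if_splits)
qed

lemma PTe_fully_nondeterministic:
  assumes L: "nplts L" "fully_nondeterministic L" and s1: "s1 \<in> states L" and s2: "s2 \<in> states L"
  shows "PTe_supinf fully_nondeterministic L s1 s2 \<longleftrightarrow> Te_fnd L s1 s2"
    "PTe_forall_exists fully_nondeterministic L s1 s2 \<longleftrightarrow> Te_fnd L s1 s2"
proof -
  define V where "V T w s q = success_prob w ` Res_max (interaction L T) (s, q)" for T w s q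
  have "Te_fnd L s1 s2 \<longleftrightarrow> (\<forall>T w q. npt (actions L) T w \<and> fully_nondeterministic T \<and> q \<in> states T \<longrightarrow>
      V T w s1 q = V T w s2 q)"
    unfolding Te_fnd_def
  proof (intro iff_allI imp_cong refl, elim conjE)
    fix T w q assume T: "npt (actions L) T w" "fully_nondeterministic T" "q \<in> states T"
    note 1 = success_probs_nondeterministic[OF L s1 T, folded V_def]
    note 2 = success_probs_nondeterministic[OF L s2 T, folded V_def]
    show "((SC (interaction L T) w (s1, q) \<noteq> {} \<longleftrightarrow> SC (interaction L T) w (s2, q) \<noteq> {}) \<and>
        ((\<forall>c. maximal_computation (interaction L T) (s1, q) c \<longrightarrow>
              c \<in> SC (interaction L T) w (s1, q)) \<longleftrightarrow>
         (\<forall>c. maximal_computation (interaction L T) (s2, q) c \<longrightarrow>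
              c \<in> SC (interaction L T) w (s2, q)))) \<longleftrightarrow> V T w s1 q = V T w s2 q"
      unfolding 1(3,4) 2(3,4) by (rule Sup_Inf_zero_one_eq_iff(2)[OF 1(1,2) 2(1,2)])
  qed
  moreover have "PTe_supinf fully_nondeterministic L s1 s2 \<longleftrightarrow>
    (\<forall>T w q. npt (actions L) T w \<and> fully_nondeterministic T \<and> q \<in> states T \<longrightarrow> V T w s1 q = V T w s2 q)"
    unfolding PTe_supinf_def
  proof (intro iff_allI imp_cong refl, elim conjE, fold V_def)
    fix T w q assume T: "npt (actions L) T w" "fully_nondeterministic T" "q \<in> states T"
    note 1 = success_probs_nondeterministic[OF L s1 T, folded V_def]
    note 2 = success_probs_nondeterministic[OF L s2 T, folded V_def]
    show "(Sup (V T w s1 q) = Sup (V T w s2 q) \<and> Inf (V T w s1 q) = Inf (V T w s2 q)) \<longleftrightarrow> V T w s1 q = V T w s2 q"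
      by (rule Sup_Inf_zero_one_eq_iff(1)[OF 1(1,2) 2(1,2)])
  qed
  moreover have "PTe_forall_exists fully_nondeterministic L s1 s2 \<longleftrightarrow>
    (\<forall>T w q. npt (actions L) T w \<and> fully_nondeterministic T \<and> q \<in> states T \<longrightarrow> V T w s1 q = V T w s2 q)"
    unfolding PTe_forall_exists_def forall_exists_iff_image_eq V_def ..
  ultimately show "PTe_supinf fully_nondeterministic L s1 s2 \<longleftrightarrow> Te_fnd L s1 s2"
    "PTe_forall_exists fully_nondeterministic L s1 s2 \<longleftrightarrow> Te_fnd L s1 s2"
    by simp_all
qed

section \<open>Tests on which all maximal resolutions agree, and the fully probabilistic
  case\<close>

lemma success_probs_constant:
  assumes "nplts L" "s \<in> states L" "npt (actions L) T w" "q \<in> states T"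
    and "\<And>Z. Z \<in> Res_max (interaction L T) (s, q) \<Longrightarrow> success_prob w Z = v"
  shows "success_prob w ` Res_max (interaction L T) (s, q) = {v}"
proof -
  have "nplts (interaction L T)" "(s, q) \<in> states (interaction L T)"
    using assms by (auto simp: npt_def nplts_interaction states_interaction)
  from Res_max_nonempty[OF this] show ?thesis using assms(5) by auto
qed

text \<open>On such a test each set of success probabilities is a singleton, so either equivalence
  forces the two values to agree. The disjunction lets the two reactive implications share one
  proof.\<close>

lemma PTe_constant_test:
  assumes "PTe_supinf Adm L s1 s2 \<or> PTe_forall_exists Adm L s1 s2"
    and s: "s1 \<in> states L" "s2 \<in> states L" and L: "nplts L"
    and T: "npt (actions L) T w" "Adm T" "q \<in> states T"
    and v: "\<And>Z. Z \<in> Res_max (interaction L T) (s1, q) \<Longrightarrow> success_prob w Z = v1"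
      "\<And>Z. Z \<in> Res_max (interaction L T) (s2, q) \<Longrightarrow> success_prob w Z = v2"
  shows "v1 = v2"
proof -
  note img = success_probs_constant[OF L s(1) T(1,3) v(1)] success_probs_constant[OF L s(2) T(1,3) v(2)]
  from assms(1) show ?thesis
  proof
    assume "PTe_supinf Adm L s1 s2"
    then have "(SUP Z \<in> Res_max (interaction L T) (s1, q). success_prob w Z) =
        (SUP Z \<in> Res_max (interaction L T) (s2, q). success_prob w Z)"
      using T unfolding PTe_supinf_def by metis
    then show ?thesis by (simp add: img)
  next
    assume "PTe_forall_exists Adm L s1 s2"
    then have "success_prob w ` Res_max (interaction L T) (s1, q) = success_prob w ` Res_max (interaction L T) (s2, q)"
      using T unfolding PTe_forall_exists_def forall_exists_iff_image_eq by metis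
    then show ?thesis by (simp add: img)
  qed
qed

lemma PTe_fully_probabilistic:
  assumes L: "nplts L" "fully_probabilistic L" and s: "s1 \<in> states L" "s2 \<in> states L"
  shows "PTe_supinf fully_probabilistic L s1 s2 \<longleftrightarrow> Te_fpr L s1 s2"
    "PTe_forall_exists fully_probabilistic L s1 s2 \<longleftrightarrow> Te_fpr L s1 s2"
proof -
  have "success_prob w Z = prob_of (interaction L T) (s, q) (SC (interaction L T) w (s, q))"
    if "npt (actions L) T w" "fully_probabilistic T" "Z \<in> Res_max (interaction L T) (s, q)" for T w q s Z
    using that L by (intro success_prob_fully_probabilistic)
      (auto simp: npt_def nplts_interaction fully_probabilistic_interaction)
  then have img: "success_prob w ` Res_max (interaction L T) (s, q) =
      {prob_of (interaction L T) (s, q) (SC (interaction L T) w (s, q))}"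
    if "npt (actions L) T w \<and> fully_probabilistic T \<and> q \<in> states T" "s \<in> states L" for T w q s
    using that by (intro success_probs_constant L) auto
  show "PTe_supinf fully_probabilistic L s1 s2 \<longleftrightarrow> Te_fpr L s1 s2"
    unfolding PTe_supinf_def Te_fpr_def by (intro iff_allI imp_cong refl) (simp add: img s)
  show "PTe_forall_exists fully_probabilistic L s1 s2 \<longleftrightarrow> Te_fpr L s1 s2"
    unfolding PTe_forall_exists_def Te_fpr_def forall_exists_iff_image_eq
    by (intro iff_allI imp_cong refl) (simp add: img s)
qed

section \<open>Trace probabilities in reactive systems\<close>

text \<open>Bridges the infinite sums in \<open>prob_of\<close> and the expectations in
  \<open>trace_prob\<close>. The terms are dominated by the weights of \<open>D\<close>, which gives
  summability.\<close>

lemma has_sum_expectation: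
  fixes v :: "'a \<Rightarrow> real"
  assumes v: "\<And>y. y \<in> set_pmf D \<Longrightarrow> 0 \<le> v y \<and> v y \<le> 1"
  shows "((\<lambda>y. pmf D y * v y) has_sum measure_pmf.expectation D v) (set_pmf D)"
proof -
  have abs: "Infinite_Set_Sum.abs_summable_on (\<lambda>y. pmf D y * v y) UNIV"
  proof (rule Infinite_Set_Sum.abs_summable_on_comparison_test'[OF pmf_abs_summable[of D]])
    fix y
    show "norm (pmf D y * v y) \<le> pmf D y"
    proof (cases "y \<in> set_pmf D")
      case True
      then show ?thesis using v[of y] by (simp add: abs_mult mult_left_le)
    next
      case False
      then show ?thesis by (simp add: set_pmf_iff)
    qed
  qed
  then have "(\<lambda>y. pmf D y * v y) summable_on UNIV"
    by (simp add: abs_summable_equivalent[symmetric] abs_summable_summable)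
  then have "((\<lambda>y. pmf D y * v y) has_sum measure_pmf.expectation D v) UNIV"
    unfolding pmf_expectation_eq_infsetsum infsetsum_infsum[OF abs] by (rule has_sum_infsum)
  then show ?thesis
    by (subst has_sum_cong_neutral[where T = UNIV]) (auto simp: set_pmf_iff)
qed

lemma expectation_zero_one:
  fixes v :: "'a \<Rightarrow> real"
  assumes v: "\<And>y. y \<in> set_pmf D \<Longrightarrow> 0 \<le> v y \<and> v y \<le> 1"
  shows "0 \<le> measure_pmf.expectation D v" "measure_pmf.expectation D v \<le> 1"
proof -
  note v' = has_sum_expectation[OF v]
  show "0 \<le> measure_pmf.expectation D v"
    by (rule has_sum_nonneg[OF v']) (use v in auto)
  have "((\<lambda>y. pmf D y * 1) has_sum measure_pmf.expectation D (\<lambda>_. 1)) (set_pmf D)"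
    by (rule has_sum_expectation) simp
  then show "measure_pmf.expectation D v \<le> 1"
    using has_sum_mono[OF v'] v by (fastforce simp: mult_left_le)
qed

lemma comp_prob_nonneg: "0 \<le> comp_prob N s c"
  by (induction N s c rule: comp_prob.induct) auto

text \<open>Prefixing with \<open>(a, y)\<close> is injective on the disjoint union of the sets
  \<open>C y\<close>, and the block of \<open>y\<close> contributes \<open>pmf D y * v y\<close>;
  these add up to the expectation.\<close>

lemma has_sum_comp_prob_step:
  fixes N :: "('s, 'a) nplts"
  assumes D: "(THE D. (z, a, D) \<in> transitions N) = D"
    and C: "\<And>y. y \<in> set_pmf D \<Longrightarrow> (comp_prob N y has_sum v y) (C y)"
    and v: "\<And>y. y \<in> set_pmf D \<Longrightarrow> 0 \<le> v y \<and> v y \<le> 1"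
  shows "(comp_prob N z has_sum measure_pmf.expectation D v)
    {(a, y) # c | y c. y \<in> set_pmf D \<and> c \<in> C y}"
proof -
  define g where "g = (\<lambda>(y, c). (a, y) # c :: ('s, 'a) comp)"
  have img: "{(a, y) # c | y c. y \<in> set_pmf D \<and> c \<in> C y} = g ` Sigma (set_pmf D) C"
    by (auto simp: g_def)
  have inj: "inj_on g (Sigma (set_pmf D) C)" by (auto simp: g_def inj_on_def)
  have f: "((\<lambda>c. (\<lambda>(y, c). pmf D y * comp_prob N y c) (y, c)) has_sum pmf D y * v y) (C y)"
    if "y \<in> set_pmf D" for y
    using has_sum_cmult_right[OF C[OF that], of "pmf D y"] by simp
  have "((\<lambda>(y, c). pmf D y * comp_prob N y c) has_sum measure_pmf.expectation D v) (Sigma (set_pmf D) C)"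
  proof (rule has_sum_SigmaI[OF f has_sum_expectation[OF v]])
    \<comment> \<open>The terms are nonnegative, so summable blocks with summable block sums give
      summability over the whole union.\<close>
    show "(\<lambda>(y, c). pmf D y * comp_prob N y c) summable_on Sigma (set_pmf D) C"
      by (rule summable_on_SigmaI[OF f has_sum_imp_summable[OF has_sum_expectation[OF v]]])
        (auto simp: comp_prob_nonneg)
  qed
  moreover have "comp_prob N z \<circ> g = (\<lambda>(y, c). pmf D y * comp_prob N y c)"
    by (auto simp: g_def fun_eq_iff D)
  ultimately show ?thesis
    unfolding img has_sum_reindex[OF inj] by simp
qed

section \<open>Probability of a trace, without reference to resolutions\<close>

text \<open>For reactive \<open>N\<close>, the probability that all actions of \<alpha>, forced one
  after another from \<open>x\<close>, can be performed and lead to a state satisfying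
  \<open>P\<close>.\<close>

fun trace_prob :: "('s, 'a) nplts \<Rightarrow> ('s \<Rightarrow> bool) \<Rightarrow> 'a list \<Rightarrow> 's \<Rightarrow> real" where
  "trace_prob N P [] x = of_bool (P x)"
| "trace_prob N P (a # \<alpha>) x = (if \<exists>D. (x, a, D) \<in> transitions N
     then measure_pmf.expectation (THE D. (x, a, D) \<in> transitions N) (trace_prob N P \<alpha>) else 0)"

lemma trace_prob_zero_one: "0 \<le> trace_prob N P \<alpha> x \<and> trace_prob N P \<alpha> x \<le> 1"
  by (induction \<alpha> arbitrary: x) (auto intro!: expectation_zero_one)

lemma reactive_the:
  "reactive_probabilistic N \<Longrightarrow> (x, a, D) \<in> transitions N \<Longrightarrow> (THE D. (x, a, D) \<in> transitions N) = D"
  unfolding reactive_probabilistic_def by (rule the_equality) metis+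

text \<open>Reactivity leaves no choice once the action is fixed, so the decomposition by the first
  step matches the recursion of \<open>trace_prob\<close>.\<close>

lemma has_sum_trace_prob:
  assumes N: "nplts N" "reactive_probabilistic N"
  shows "x \<in> states N \<Longrightarrow> (comp_prob N x has_sum trace_prob N P \<alpha> x)
    {c. computation N x c \<and> trace_of c = \<alpha> \<and> P (last_state x c)}"
proof (induction \<alpha> arbitrary: x)
  case Nil
  have "{c. computation N x c \<and> trace_of c = [] \<and> P (last_state x c)} = (if P x then {[]} else {})"
    using Nil by (auto simp: trace_of_def)
  then show ?case by (auto intro!: has_sum_finiteI)
next
  case (Cons a \<alpha>)
  show ?case
  proof (cases "\<exists>D. (x, a, D) \<in> transitions N")
    case True
    then obtain D where D: "(x, a, D) \<in> transitions N" by blast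
    have D_uniq: "E = D" if "(x, a, E) \<in> transitions N" for E
      using N(2) D that unfolding reactive_probabilistic_def by metis
    have "{c. computation N x c \<and> trace_of c = a # \<alpha> \<and> P (last_state x c)} =
      {(a, y) # c | y c. y \<in> set_pmf D \<and>
        c \<in> {c. computation N y c \<and> trace_of c = \<alpha> \<and> P (last_state y c)}}" (is "?L = ?R")
    proof (intro subset_antisym subsetI)
      fix c assume c: "c \<in> ?L"
      then obtain b y d where "c = (b, y) # d" by (cases c) (auto simp: trace_of_def)
      with c D_uniq show "c \<in> ?R" by (auto simp: trace_of_def)
    next
      fix c assume "c \<in> ?R"
      then show "c \<in> ?L" using D by (auto simp: trace_of_def)
    qed
    moreover have "(comp_prob N x has_sum measure_pmf.expectation D (trace_prob N P \<alpha>))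
      {(a, y) # c | y c. y \<in> set_pmf D \<and>
        c \<in> {c. computation N y c \<and> trace_of c = \<alpha> \<and> P (last_state y c)}}"
    proof (rule has_sum_comp_prob_step[OF reactive_the[OF N(2) D]])
      fix y assume "y \<in> set_pmf D"
      then have "y \<in> states N" using nplts_transD(3)[OF N(1) D] by auto
      then show "(comp_prob N y has_sum trace_prob N P \<alpha> y)
          {c. computation N y c \<and> trace_of c = \<alpha> \<and> P (last_state y c)}" by (rule Cons.IH)
    qed (rule trace_prob_zero_one)
    ultimately show ?thesis using True reactive_the[OF N(2) D] by simp
  next
    case False
    then have no: "(x, a, D) \<notin> transitions N" for D by blast
    have empty: "{c. computation N x c \<and> trace_of c = a # \<alpha> \<and> P (last_state x c)} = {}"
    proof -
      have False if "computation N x c" "trace_of c = a # \<alpha>" for c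
        using that no by (cases c) (auto simp: trace_of_def)
      then show ?thesis by auto
    qed
    show ?thesis unfolding empty using no by simp
  qed
qed

lemma comp_prob_pos:
  assumes "reactive_probabilistic N"
  shows "computation N x c \<Longrightarrow> 0 < comp_prob N x c"
proof (induction c arbitrary: x)
  case (Cons p c)
  obtain a y where p: "p = (a, y)" by (cases p)
  then obtain D where "(x, a, D) \<in> transitions N" "y \<in> set_pmf D" "computation N y c"
    using Cons.prems by auto
  then show ?case using Cons.IH p reactive_the[OF assms] by (simp add: pmf_positive)
qed simp

text \<open>Every computation has positive probability, so demanding that the last state can still
  move lowers the probability exactly when some \<alpha>-compatible computation ends in a dead
  state. Splitting by the final test state \<open>r\<close> turns both sides into values that trace
  tests can measure.\<close>

lemma Tr_max_iff_trace_prob: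
  fixes N :: "('s \<times> nat, 'a) nplts"
  assumes N: "nplts N" "reactive_probabilistic N" and x: "x \<in> states N"
  shows "\<alpha> \<in> Tr_max N x \<longleftrightarrow>
    (\<exists>r. trace_prob N (\<lambda>y. snd y = r \<and> enabled N y) \<alpha> x < trace_prob N (\<lambda>y. snd y = r) \<alpha> x)"
proof
  assume "\<alpha> \<in> Tr_max N x"
  then obtain c where "maximal_computation N x c" "trace_of c = \<alpha>" by (auto simp: Tr_max_def)
  then have c: "computation N x c" "trace_of c = \<alpha>" "\<not> enabled N (last_state x c)"
    by (auto simp: maximal_computation_iff[OF N(1)] enabled_def)
  define r where "r = snd (last_state x c)"
  \<comment> \<open>\<open>c\<close> lies in the larger set of computations and, being dead at its
    end, not in the smaller one; its positive probability makes the inequality strict.\<close>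
  have "trace_prob N (\<lambda>y. snd y = r \<and> enabled N y) \<alpha> x < trace_prob N (\<lambda>y. snd y = r) \<alpha> x"
    by (rule has_sum_strict_mono_neutral[OF has_sum_trace_prob[OF N x] has_sum_trace_prob[OF N x], where x = c])
      (use c comp_prob_pos[OF N(2)] in \<open>auto simp: r_def comp_prob_nonneg\<close>)
  then show "\<exists>r. trace_prob N (\<lambda>y. snd y = r \<and> enabled N y) \<alpha> x < trace_prob N (\<lambda>y. snd y = r) \<alpha> x" ..
next
  assume "\<exists>r. trace_prob N (\<lambda>y. snd y = r \<and> enabled N y) \<alpha> x < trace_prob N (\<lambda>y. snd y = r) \<alpha> x"
  then obtain r where r: "trace_prob N (\<lambda>y. snd y = r \<and> enabled N y) \<alpha> x < trace_prob N (\<lambda>y. snd y = r) \<alpha> x" ..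
  \<comment> \<open>Equal index sets would give equal sums; a computation in only one of the sets
    ends in a dead state.\<close>
  have "{c. computation N x c \<and> trace_of c = \<alpha> \<and> snd (last_state x c) = r \<and> enabled N (last_state x c)} \<noteq>
      {c. computation N x c \<and> trace_of c = \<alpha> \<and> snd (last_state x c) = r}"
    using r has_sum_trace_prob[OF N x, of \<alpha> "\<lambda>y. snd y = r \<and> enabled N y"]
      has_sum_trace_prob[OF N x, of \<alpha> "\<lambda>y. snd y = r"] by (metis (no_types) has_sum_unique less_irrefl)
  then obtain c where "computation N x c" "trace_of c = \<alpha>" "\<not> enabled N (last_state x c)" by blast
  then show "\<alpha> \<in> Tr_max N x"
    unfolding Tr_max_def maximal_computation_iff[OF N(1)] enabled_def by blast
qed

text \<open>Justifies the \<open>THE\<close> in \<open>SCC_prob\<close>: in a maximal resolution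
  containing the \<alpha>-compatible computations, the successful ones project bijectively to those
  of \<open>N\<close>, which fixes the value; a scheduler playing \<alpha> shows that such a
  resolution exists.\<close>

lemma SCC_prob_eq_trace_prob:
  fixes N :: "('s \<times> nat, 'a) nplts"
  assumes N: "nplts N" "reactive_probabilistic N" and x: "x \<in> states N"
  shows "SCC_prob N w x \<alpha> = trace_prob N (\<lambda>y. snd y = w) \<alpha> x"
proof -
  have val: "prob_of (graph Z) (root Z) {c \<in> SC_res w Z. trace_of c = \<alpha>} = trace_prob N (\<lambda>y. snd y = w) \<alpha> x"
    if Z: "Z \<in> Res_max N x" and cc: "contains_compatible N x \<alpha> Z" for Z
  proof -
    interpret R: resolution N x Z by (rule resolution_Res_max[OF N(1) Z])
    let ?C = "{c \<in> SC_res w Z. trace_of c = \<alpha>}"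
    have last: "corr Z (last_state (root Z) d) = last_state x (R.cmap d)" for d
      using R.corr_last_state R.corr_root by metis
    have comp: "computation N x (R.cmap d)" if "computation R.G (root Z) d" for d
      using R.computation_cmap[OF that] R.corr_root by simp
    have "R.cmap ` ?C = {c. computation N x c \<and> trace_of c = \<alpha> \<and> snd (last_state x c) = w}"
    proof (intro subset_antisym subsetI)
      fix c assume "c \<in> R.cmap ` ?C"
      then show "c \<in> {c. computation N x c \<and> trace_of c = \<alpha> \<and> snd (last_state x c) = w}"
        using comp last by (auto simp: SC_res_def)
    next
      fix c assume c: "c \<in> {c. computation N x c \<and> trace_of c = \<alpha> \<and> snd (last_state x c) = w}"
      then obtain d where d: "computation R.G (root Z) d" "R.cmap d = c"
        using cc unfolding contains_compatible_def corr_comp_def by blast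
      then have "trace_of d = \<alpha>" using c by (metis (mono_tags, lifting) mem_Collect_eq trace_corr_comp)
      then show "c \<in> R.cmap ` ?C" using c d last[of d] by (auto simp: SC_res_def)
    qed
    moreover have "?C \<subseteq> {c. computation R.G (root Z) c}" by (auto simp: SC_res_def)
    ultimately have "prob_of R.G (root Z) ?C =
        prob_of N x {c. computation N x c \<and> trace_of c = \<alpha> \<and> snd (last_state x c) = w}"
      using R.prob_of_cmap[OF N(2), of ?C "root Z"] R.corr_root by simp
    also have "\<dots> = trace_prob N (\<lambda>y. snd y = w) \<alpha> x"
      unfolding prob_of_def by (rule infsumI[OF has_sum_trace_prob[OF N x]])
    finally show ?thesis .
  qed
  have "\<exists>Z \<in> Res_max N x. contains_compatible N x \<alpha> Z"
  proof -
    \<comment> \<open>After a history of length n, the letter of \<alpha> at index n (counted from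
      0) is played whenever possible, with the only distribution that reactivity leaves.\<close>
    define \<rho> where "\<rho> h = (if length h < length \<alpha> \<and> (\<exists>D. (last_state x h, \<alpha> ! length h, D) \<in> transitions N)
      then Some (\<alpha> ! length h, THE D. (last_state x h, \<alpha> ! length h, D) \<in> transitions N) else None)"
      for h :: "('s \<times> nat, 'a) comp"
    have "(last_state x h, t) \<in> transitions N" if "\<rho> h = Some t" for h t
      using that reactive_the[OF N(2)] by (auto simp: \<rho>_def split: if_splits)
    then obtain \<sigma> where \<sigma>: "scheduler N x \<sigma>" "\<And>h t. \<rho> h = Some t \<Longrightarrow> \<sigma> h = Some t"
      using scheduler_extending[of N x \<rho>] by metis
    obtain Z where Z: "Z \<in> Res_max N x" and
      Z\<sigma>: "\<And>c a D. computation (graph Z) (root Z) c \<Longrightarrow> (last_state (root Z) c, a, D) \<in> transitions (graph Z) \<Longrightarrow>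
        \<sigma> (corr_comp Z c) = Some (a, map_pmf (corr Z) D)"
      using scheduled_resolution[OF N(1) x \<sigma>(1)] by metis
    interpret R: resolution N x Z by (rule resolution_Res_max[OF N(1) Z])
    \<comment> \<open>Generalised to traces that are prefixes of \<alpha>, so that the induction can
      remove the last step.\<close>
    have "computation N x c \<Longrightarrow> prefix (trace_of c) \<alpha> \<Longrightarrow>
        \<exists>d. computation R.G (root Z) d \<and> R.cmap d = c" for c
    proof (induction c rule: rev_induct)
      case Nil
      then show ?case using R.root_state by (intro exI[of _ "[]"]) simp
    next
      case (snoc p c)
      obtain a y where p: "p = (a, y)" by (cases p)
      obtain D where D: "computation N x c" "(last_state x c, a, D) \<in> transitions N" "y \<in> set_pmf D"
        using snoc.prems by (auto simp: computation_snoc[OF N(1)] p)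
      obtain \<beta> where \<beta>: "\<alpha> = trace_of c @ a # \<beta>"
        using snoc.prems(2) by (auto simp: p trace_of_def prefix_def)
      then obtain d where d: "computation R.G (root Z) d" "R.cmap d = c"
        using snoc.IH[OF D(1)] by auto
      have last: "corr Z (last_state (root Z) d) = last_state x c"
        using R.corr_last_state R.corr_root d(2) by metis
      then have "enabled N (corr Z (last_state (root Z) d))" using D(2) by (auto simp: enabled_def)
      then have "enabled R.G (last_state (root Z) d)"
        by (rule R.Res_max_enabled[OF Z computation_last[OF d(1)]])
      then obtain b E where E: "(last_state (root Z) d, b, E) \<in> transitions R.G" by (auto simp: enabled_def)
      have "length c < length \<alpha>" "\<alpha> ! length c = a" by (simp_all add: \<beta> trace_of_def nth_append)
      then have "\<rho> c = Some (a, D)" using D(2) reactive_the[OF N(2) D(2)] by (auto simp: \<rho>_def)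
      then have "b = a" "map_pmf (corr Z) E = D" using Z\<sigma>[OF d(1) E] \<sigma>(2) d(2) by fastforce+
      then obtain z where z: "z \<in> set_pmf E" "corr Z z = y" using D(3) by auto
      have "computation R.G (root Z) (d @ [(a, z)])"
        using d E z \<open>b = a\<close> by (auto simp: computation_snoc[OF R.nplts_G])
      then show ?case using d z p by (intro exI[of _ "d @ [(a, z)]"]) simp
    qed
    then have "contains_compatible N x \<alpha> Z"
      unfolding contains_compatible_def corr_comp_def by auto
    then show ?thesis using Z by blast
  qed
  then show ?thesis
    unfolding SCC_prob_def by (intro the_equality) (use val in auto)
qed

section \<open>Tests following a single trace\<close>

definition test_state :: "nat \<Rightarrow> bool \<Rightarrow> nat \<Rightarrow> nat \<Rightarrow> nat" where
  "test_state r probe k q = (if k = 0 \<and> q = r \<and> \<not> probe then 0 else Suc (prod_encode (k, q)))"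

text \<open>
  The test state \<open>test_state r probe k q\<close> is the copy of \<open>q\<close> with \<open>k\<close> actions of the trace left;
  \<open>0\<close> is the success state.
\<close>

definition trace_test :: "(nat, 'a) nplts \<Rightarrow> nat \<Rightarrow> bool \<Rightarrow> 'a list \<Rightarrow> (nat, 'a) nplts" where
  "trace_test T r probe \<alpha> =
     \<lparr> states = insert 0 {test_state r probe (length \<beta>) q | \<beta> q. suffix \<beta> \<alpha> \<and> q \<in> states T},
       actions = actions T,
       transitions =
         {(test_state r probe (Suc (length \<beta>)) q, a, map_pmf (test_state r probe (length \<beta>)) D) | \<beta> q a D.
            suffix (a # \<beta>) \<alpha> \<and> (q, a, D) \<in> transitions T} \<union>
         {(test_state r probe 0 r, a, return_pmf 0) | a D. probe \<and> (r, a, D) \<in> transitions T} \<rparr>"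

text \<open>Without probing, the copy of \<open>r\<close> with no letters left is the success state
  \<open>0\<close> itself; every other copy has a positive code, so this identification merges no
  two copies.\<close>

lemma test_state_eq_iff: "test_state r probe k q = test_state r probe k' q' \<longleftrightarrow> k = k' \<and> q = q'"
  by (auto simp: test_state_def)

lemma inj_test_state: "inj (test_state r probe k)"
  by (simp add: inj_def test_state_eq_iff)

lemma test_state_eq_0_iff: "test_state r probe k q = 0 \<longleftrightarrow> k = 0 \<and> q = r \<and> \<not> probe"
  by (auto simp: test_state_def)

lemma suffix_length_eq: "suffix \<beta> \<alpha> \<Longrightarrow> suffix \<gamma> \<alpha> \<Longrightarrow> length \<beta> = length \<gamma> \<Longrightarrow> \<beta> = \<gamma>"
  by (auto simp: suffix_def append_eq_append_conv)

lemma trans_trace_test: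
  "(m, a, E) \<in> transitions (trace_test T r probe \<alpha>) \<longleftrightarrow>
    (\<exists>\<beta> q D. suffix (a # \<beta>) \<alpha> \<and> (q, a, D) \<in> transitions T \<and> m = test_state r probe (Suc (length \<beta>)) q \<and>
       E = map_pmf (test_state r probe (length \<beta>)) D) \<or>
    (probe \<and> m = test_state r probe 0 r \<and> E = return_pmf 0 \<and> (\<exists>D. (r, a, D) \<in> transitions T))"
  by (auto simp: trace_test_def)

lemma trans_trace_test_0: "(0, a, E) \<notin> transitions (trace_test T r probe \<alpha>)"
  using test_state_eq_0_iff by (metis trans_trace_test Zero_not_Suc)

lemma trans_trace_test_Nil:
  "(test_state r probe 0 q, a, E) \<in> transitions (trace_test T r probe \<alpha>) \<longleftrightarrow>
    probe \<and> q = r \<and> E = return_pmf 0 \<and> (\<exists>D. (r, a, D) \<in> transitions T)"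
  by (auto simp: trans_trace_test test_state_eq_iff)

text \<open>The number of remaining letters determines the suffix, hence the single action on
  offer.\<close>

lemma trans_trace_test_Cons:
  assumes "suffix (b # \<gamma>) \<alpha>"
  shows "(test_state r probe (Suc (length \<gamma>)) q, a, E) \<in> transitions (trace_test T r probe \<alpha>) \<longleftrightarrow>
    a = b \<and> (\<exists>D. (q, b, D) \<in> transitions T \<and> E = map_pmf (test_state r probe (length \<gamma>)) D)"
proof -
  have "a = b \<and> \<beta> = \<gamma>" if "suffix (a # \<beta>) \<alpha>" "length \<beta> = length \<gamma>" for \<beta>
    using suffix_length_eq[OF that(1) assms] that(2) by simp
  then show ?thesis using assms by (auto simp: trans_trace_test test_state_eq_iff)
qed

lemma reactive_trace_test:
  assumes "reactive_probabilistic T"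
  shows "reactive_probabilistic (trace_test T r probe \<alpha>)"
  unfolding reactive_probabilistic_def
proof (intro allI impI, elim conjE)
  fix m a D D'
  assume D: "(m, a, D) \<in> transitions (trace_test T r probe \<alpha>)"
    and D': "(m, a, D') \<in> transitions (trace_test T r probe \<alpha>)"
  from D consider \<beta> q E where "suffix (a # \<beta>) \<alpha>" "(q, a, E) \<in> transitions T"
      "m = test_state r probe (Suc (length \<beta>)) q" "D = map_pmf (test_state r probe (length \<beta>)) E"
    | "m = test_state r probe 0 r" "D = return_pmf 0"
    unfolding trans_trace_test by blast
  then show "D = D'"
  proof cases
    case 1
    with D' have "\<exists>E'. (q, a, E') \<in> transitions T \<and> D' = map_pmf (test_state r probe (length \<beta>)) E'"
      by (simp add: trans_trace_test_Cons)
    with 1 assms show ?thesis unfolding reactive_probabilistic_def by metis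
  next
    case 2
    with D' show ?thesis by (simp add: trans_trace_test_Nil)
  qed
qed

lemma test_state_in_trace_test:
  "suffix \<beta> \<alpha> \<Longrightarrow> q \<in> states T \<Longrightarrow> test_state r probe (length \<beta>) q \<in> states (trace_test T r probe \<alpha>)"
  by (auto simp: trace_test_def)

lemma nplts_trace_test:
  assumes T: "nplts T"
  shows "nplts (trace_test T r probe \<alpha>)"
proof -
  have "m \<in> states (trace_test T r probe \<alpha>) \<and> a \<in> actions T \<and> set_pmf E \<subseteq> states (trace_test T r probe \<alpha>)"
    if t: "(m, a, E) \<in> transitions (trace_test T r probe \<alpha>)" for m a E
  proof -
    from t consider \<beta> q D where "suffix (a # \<beta>) \<alpha>" "(q, a, D) \<in> transitions T"
        "m = test_state r probe (Suc (length \<beta>)) q" "E = map_pmf (test_state r probe (length \<beta>)) D"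
      | D where "m = test_state r probe 0 r" "E = return_pmf 0" "(r, a, D) \<in> transitions T"
      unfolding trans_trace_test by blast
    then show ?thesis
    proof cases
      case 1
      then show ?thesis
        using nplts_transD[OF T 1(2)] test_state_in_trace_test[OF 1(1)]
          test_state_in_trace_test[OF suffix_ConsD[OF 1(1)]] by auto
    next
      case 2
      then show ?thesis
        using nplts_transD[OF T 2(3)] test_state_in_trace_test[of "[]" \<alpha>] by (auto simp: trace_test_def)
    qed
  qed
  moreover have "actions (trace_test T r probe \<alpha>) = actions T" by (simp add: trace_test_def)
  ultimately show ?thesis using T unfolding nplts_def by auto
qed

lemma npt_trace_test:
  assumes T: "npt A T w"
  shows "npt A (trace_test T r probe \<alpha>) 0"
proof -
  let ?T = "trace_test T r probe \<alpha>" and ?ts = "test_state r probe"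
  have fin: "finite (states T)" "finite (transitions T)" and nT: "nplts T" "actions T = A"
    using T by (auto simp: npt_def)
  have "states ?T \<subseteq> insert 0 ((\<lambda>(\<beta>, q). ?ts (length \<beta>) q) ` (set (suffixes \<alpha>) \<times> states T))"
    by (auto simp: trace_test_def)
  then have 1: "finite (states ?T)" using fin by (auto intro: finite_subset)
  have "transitions ?T \<subseteq>
      (\<lambda>(\<beta>, q, a, D). (?ts (Suc (length \<beta>)) q, a, map_pmf (?ts (length \<beta>)) D)) ` (set (suffixes \<alpha>) \<times> transitions T) \<union>
      (\<lambda>(q, a, D). (?ts 0 r, a, return_pmf 0)) ` transitions T"
    by (auto simp: trace_test_def image_iff dest!: suffix_ConsD) force+
  then have 2: "finite (transitions ?T)" using fin by (auto intro: finite_subset)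
  have 3: "acyclic (step_relation ?T)"
  proof -
    \<comment> \<open>The number of remaining letters plus one, and 0 for the success state. The
      shift by one lets a probing step, from level 0 to success, also lower the rank.\<close>
    define rank where "rank m = (if m = 0 then 0 else Suc (fst (prod_decode (m - 1))))" for m
    \<comment> \<open>At level 0 only an inequality holds, because the copy of \<open>r\<close> may
      be the success state itself.\<close>
    have rank: "rank (?ts k q) \<le> Suc k" "0 < k \<Longrightarrow> rank (?ts k q) = Suc k" for k q
      by (auto simp: rank_def test_state_def)
    have "(step_relation ?T)\<inverse> \<subseteq> inv_image less_than rank"
    proof
      fix p assume "p \<in> (step_relation ?T)\<inverse>"
      then obtain m m' a E where p: "p = (m', m)" and t: "(m, a, E) \<in> transitions ?T" and m': "m' \<in> set_pmf E"
        by (auto simp: step_relation_def)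
      from t consider k q D where "m = ?ts (Suc k) q" "E = map_pmf (?ts k) D"
        | "probe" "m = ?ts 0 r" "E = return_pmf 0"
        unfolding trans_trace_test by blast
      then have "rank m' < rank m"
      proof cases
        case 1
        then obtain q' where "m' = ?ts k q'" using m' by auto
        then show ?thesis using rank(1)[of k q'] rank(2)[of "Suc k" q] 1 by simp
      next
        case 2
        then show ?thesis using m' by (simp add: rank_def test_state_def)
      qed
      then show "p \<in> inv_image less_than rank" by (simp add: p)
    qed
    then have "acyclic ((step_relation ?T)\<inverse>)" by (metis wf_acyclic wf_inv_image wf_less_than wf_subset)
    then show ?thesis by simp
  qed
  have "actions ?T = A" "0 \<in> states ?T" using nT(2) by (simp_all add: trace_test_def)
  then show ?thesis
    unfolding npt_def using 1 2 3 nplts_trace_test[OF nT(1)] trans_trace_test_0 by metis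
qed

section \<open>Success probability of the trace tests\<close>

context resolution
begin

lemma accepting_runs_dead:
  assumes "z \<in> states G" "\<not> enabled N (corr Z z)"
  shows "{c. computation G z c \<and> P (last_state z c)} = (if P z then {[]} else {})"
proof -
  have "(z, a, D) \<notin> transitions G" for a D
    using assms(2) corr_trans(1) unfolding enabled_def by metis
  then have iff: "computation G z c \<longleftrightarrow> c = []" for c using assms(1) by (cases c) auto
  show ?thesis unfolding iff by auto
qed

lemma accepting_runs_step:
  assumes "(z, a, D) \<in> transitions G" "\<not> P z"
  shows "{c. computation G z c \<and> P (last_state z c)} =
    {(a, y) # c | y c. y \<in> set_pmf D \<and> c \<in> {c. computation G y c \<and> P (last_state y c)}}" (is "?L = ?R")
proof (intro subset_antisym subsetI)
  fix c assume c: "c \<in> ?L"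
  then obtain b y d where d: "c = (b, y) # d" using assms(2) by (cases c) auto
  then obtain E where E: "(z, b, E) \<in> transitions G" "y \<in> set_pmf E" using c by auto
  with trans_unique[OF assms(1) E(1)] show "c \<in> ?R" using c d by auto
qed (use assms in auto)

end

text \<open>While letters remain, only the next one is on offer and reactivity fixes the
  distribution; a probing step may choose its action but then succeeds with certainty. So the value
  at \<open>z\<close> depends only on its counterpart, and induction on the remaining suffix
  applies.\<close>

lemma has_sum_trace_test:
  assumes L: "nplts L" "reactive_probabilistic L" and T: "nplts T" "reactive_probabilistic T"
    and Z: "Z \<in> Res_max (interaction L (trace_test T r probe \<alpha>)) x"
  defines "M \<equiv> interaction L T"
  defines "P \<equiv> \<lambda>y. snd y = r \<and> (probe \<longrightarrow> enabled M y)"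
  shows "suffix \<beta> \<alpha> \<Longrightarrow> z \<in> states (graph Z) \<Longrightarrow> corr Z z = (s, test_state r probe (length \<beta>) q) \<Longrightarrow>
    (comp_prob (graph Z) z has_sum trace_prob M P \<beta> (s, q))
      {c. computation (graph Z) z c \<and> snd (corr Z (last_state z c)) = 0}"
proof (induction \<beta> arbitrary: z s q)
  define N where "N = interaction L (trace_test T r probe \<alpha>)"
  have nN: "nplts N" unfolding N_def by (intro nplts_interaction L nplts_trace_test T)
  interpret R: resolution N x Z by (rule resolution_Res_max[OF nN Z[folded N_def]])
  have enabledG: "enabled R.G z" if "z \<in> states R.G" "enabled N (corr Z z)" for z
    using R.Res_max_enabled[OF Z[folded N_def]] that .
  have M: "reactive_probabilistic M" unfolding M_def by (intro reactive_probabilistic_interaction L T)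
  have dead0: "\<not> enabled N (s, 0)" for s
    using trans_trace_test_0 by (metis N_def enabled_def trans_interaction)
  {
    case (Nil z s q)
    \<comment> \<open>No letters left: the copy of \<open>r\<close> is the success state; or it is
      probed and \<open>L\<close> and \<open>T\<close> can still move together; or the configuration
      is dead without success.\<close>
    consider "\<not> probe" "q = r" | "probe" "q = r" "enabled M (s, q)"
      | "\<not> P (s, q)" "\<not> enabled N (s, test_state r probe 0 q)" "test_state r probe 0 q \<noteq> 0"
      by (auto simp: P_def enabled_def M_def N_def trans_interaction trans_trace_test_Nil test_state_eq_0_iff)
    then show ?case
    proof cases
      case 1
      then have z: "corr Z z = (s, 0)" using Nil by (simp add: test_state_def)
      have "{c. computation R.G z c \<and> snd (corr Z (last_state z c)) = 0} = {[]}"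
        using R.accepting_runs_dead[of z "\<lambda>y. snd (corr Z y) = 0"] Nil(2) dead0 z by simp
      then show ?thesis using 1 by (simp add: P_def has_sum_finiteI)
    next
      case 2
      obtain a D1 D2 where D12: "(s, a, D1) \<in> transitions L" "(q, a, D2) \<in> transitions T"
        using 2(3) by (auto simp: enabled_def M_def trans_interaction)
      have "enabled N (corr Z z)"
        using D12 2 Nil(3) unfolding enabled_def N_def
        by (auto simp: trans_interaction trans_trace_test_Nil)
      then obtain b E where E: "(z, b, E) \<in> transitions R.G"
        using enabledG Nil(2) unfolding enabled_def by metis
      have tN: "((s, test_state r probe 0 q), b, map_pmf (corr Z) E) \<in> transitions N"
        using R.corr_trans(1)[OF E] Nil(3) by simp
      \<comment> \<open>Whichever action \<open>b\<close> was chosen, the test component of the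
        target is surely the success state.\<close>
      then obtain D where D: "map_pmf (corr Z) E = pair_pmf D (return_pmf 0)"
        by (auto simp: N_def trans_interaction trans_trace_test_Nil)
      have succ: "(comp_prob R.G y has_sum 1) {c. computation R.G y c \<and> snd (corr Z (last_state y c)) = 0}"
        if y: "y \<in> set_pmf E" for y
      proof -
        have "corr Z y \<in> set_pmf (pair_pmf D (return_pmf 0))" using y by (metis D imageI set_map_pmf)
        then obtain s' where z: "corr Z y = (s', 0)" by auto
        have "y \<in> states R.G" using nplts_transD(3)[OF R.nplts_G E] y by auto
        then have "{c. computation R.G y c \<and> snd (corr Z (last_state y c)) = 0} = {[]}"
          using R.accepting_runs_dead[of y "\<lambda>y. snd (corr Z y) = 0"] dead0 z by simp
        then show ?thesis by (simp add: has_sum_finiteI)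
      qed
      have "\<not> snd (corr Z z) = 0" using Nil(3) 2 by (simp add: test_state_eq_0_iff)
      note runs = R.accepting_runs_step[of z b E "\<lambda>y. snd (corr Z y) = 0", OF E this]
      have "(comp_prob R.G z has_sum measure_pmf.expectation E (\<lambda>_. 1))
          {c. computation R.G z c \<and> snd (corr Z (last_state z c)) = 0}"
        unfolding runs by (rule has_sum_comp_prob_step[OF R.the_trans[OF E] succ]) auto
      then show ?thesis using 2 by (simp add: P_def)
    next
      case 3
      have "{c. computation R.G z c \<and> snd (corr Z (last_state z c)) = 0} = {}"
        using R.accepting_runs_dead[of z "\<lambda>y. snd (corr Z y) = 0"] Nil(2,3) 3 by simp
      then show ?thesis using 3 by (simp only: trace_prob.simps) simp
    qed
  next
    case (Cons b \<gamma> z s q)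
    let ?ts = "test_state r probe (length \<gamma>)"
    have z: "corr Z z = (s, test_state r probe (Suc (length \<gamma>)) q)" using Cons.prems(3) by simp
    have nz: "\<not> snd (corr Z z) = 0" by (simp add: z test_state_eq_0_iff)
    have tN: "(corr Z z, a, E) \<in> transitions N \<longleftrightarrow>
        a = b \<and> (\<exists>D1 D2. (s, b, D1) \<in> transitions L \<and> (q, b, D2) \<in> transitions T \<and>
          E = pair_pmf D1 (map_pmf ?ts D2))" for a E
      unfolding z N_def trans_interaction trans_trace_test_Cons[OF Cons.prems(1)] by blast
    show ?case
    proof (cases "\<exists>D. ((s, q), b, D) \<in> transitions M")
      case True
      then have "enabled N (corr Z z)"
        unfolding enabled_def tN by (auto simp: M_def trans_interaction)
      then obtain a E where E: "(z, a, E) \<in> transitions R.G"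
        using enabledG Cons.prems(2) unfolding enabled_def by metis
      obtain D1 D2 where D: "a = b" "(s, b, D1) \<in> transitions L" "(q, b, D2) \<in> transitions T"
        "map_pmf (corr Z) E = pair_pmf D1 (map_pmf ?ts D2)"
        using R.corr_trans(1)[OF E] unfolding tN by blast
      have the: "(THE D. ((s, q), b, D) \<in> transitions M) = pair_pmf D1 D2"
        by (rule reactive_the[OF M]) (use D in \<open>auto simp: M_def trans_interaction\<close>)
      \<comment> \<open>\<open>inv ?ts\<close> decodes the test component, so that the values from
        the induction hypothesis become a function on the states of \<open>Z\<close>.\<close>
      define v where "v y = trace_prob M P \<gamma> (apsnd (inv ?ts) (corr Z y))" for y
      have IH: "(comp_prob R.G y has_sum v y) {c. computation R.G y c \<and> snd (corr Z (last_state y c)) = 0}"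
        if y: "y \<in> set_pmf E" for y
      proof -
        have "corr Z y \<in> set_pmf (pair_pmf D1 (map_pmf ?ts D2))" using y by (metis D(4) imageI set_map_pmf)
        then obtain s' q' where y': "corr Z y = (s', ?ts q')" by auto
        have "y \<in> states R.G" using nplts_transD(3)[OF R.nplts_G E] y by auto
        moreover have "v y = trace_prob M P \<gamma> (s', q')"
          by (simp add: v_def y' inv_f_f[OF inj_test_state])
        ultimately show ?thesis
          using Cons.IH[OF suffix_ConsD[OF Cons.prems(1)] _ y'] by simp
      qed
      \<comment> \<open>Two changes of variables: from \<open>E\<close> to its image under
        \<open>corr Z\<close>, then along the encoding of test states.\<close>
      have "measure_pmf.expectation E v =
          measure_pmf.expectation (map_pmf (corr Z) E) (\<lambda>y. trace_prob M P \<gamma> (apsnd (inv ?ts) y))"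
        by (simp add: v_def[abs_def])
      also have "\<dots> = measure_pmf.expectation (pair_pmf D1 D2) (trace_prob M P \<gamma>)"
        unfolding D(4) pair_map_pmf2 by (simp add: apsnd_def map_prod_def split_beta inv_f_f[OF inj_test_state])
      finally have exp: "measure_pmf.expectation E v = trace_prob M P (b # \<gamma>) (s, q)"
        using True by (simp add: the)
      note runs = R.accepting_runs_step[of z a E "\<lambda>y. snd (corr Z y) = 0", OF E nz]
      show ?thesis
        unfolding exp[symmetric] runs
        by (rule has_sum_comp_prob_step[OF R.the_trans[OF E] IH]) (auto simp: v_def trace_prob_zero_one)
    next
      case False
      then have "\<not> enabled N (corr Z z)"
        unfolding enabled_def tN by (auto simp: M_def trans_interaction)
      then have empty: "{c. computation R.G z c \<and> snd (corr Z (last_state z c)) = 0} = {}"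
        using R.accepting_runs_dead[of z "\<lambda>y. snd (corr Z y) = 0"] Cons.prems(2) nz by simp
      show ?thesis unfolding empty using False by simp
    qed
  }
qed

lemma success_prob_trace_test:
  assumes L: "nplts L" "reactive_probabilistic L" and T: "nplts T" "reactive_probabilistic T"
    and Z: "Z \<in> Res_max (interaction L (trace_test T r probe \<alpha>)) (s, test_state r probe (length \<alpha>) q)"
  shows "success_prob 0 Z =
    trace_prob (interaction L T) (\<lambda>y. snd y = r \<and> (probe \<longrightarrow> enabled (interaction L T) y)) \<alpha> (s, q)"
proof -
  interpret R: resolution "interaction L (trace_test T r probe \<alpha>)" "(s, test_state r probe (length \<alpha>) q)" Z
    by (rule resolution_Res_max[OF _ Z]) (intro nplts_interaction L nplts_trace_test T)
  show ?thesis
    unfolding success_prob_def prob_of_def SC_res_def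
    by (rule infsumI[OF has_sum_trace_test[OF L T Z _ R.root_state R.corr_root]]) simp
qed

text \<open>The suprema and infima agree because both the sets of maximal traces and the functions
  on them agree, and trace tests measure each.\<close>

lemma PTe_reactive_probabilistic:
  assumes L: "nplts L" "reactive_probabilistic L" and s: "s1 \<in> states L" "s2 \<in> states L"
    and PTe: "PTe_supinf reactive_probabilistic L s1 s2 \<or> PTe_forall_exists reactive_probabilistic L s1 s2"
  shows "Te_rpr L s1 s2"
  unfolding Te_rpr_def
proof (intro allI impI, elim conjE)
  fix T w q assume T: "npt (actions L) T w" "reactive_probabilistic T" and q: "q \<in> states T"
  let ?M = "interaction L T"
  have nT: "nplts T" using T by (simp add: npt_def)
  have M: "nplts ?M" "reactive_probabilistic ?M"
    by (intro nplts_interaction L nT) (intro reactive_probabilistic_interaction L T)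
  \<comment> \<open>Started with all of \<alpha> ahead, the trace test has the same success
    probability in every maximal resolution, so either equivalence equates these values.\<close>
  have eq: "trace_prob ?M (\<lambda>y. snd y = r \<and> (probe \<longrightarrow> enabled ?M y)) \<alpha> (s1, q) =
      trace_prob ?M (\<lambda>y. snd y = r \<and> (probe \<longrightarrow> enabled ?M y)) \<alpha> (s2, q)" for r probe \<alpha>
  proof (rule PTe_constant_test[OF PTe s L(1)])
    show "npt (actions L) (trace_test T r probe \<alpha>) 0" by (rule npt_trace_test[OF T(1)])
    show "reactive_probabilistic (trace_test T r probe \<alpha>)" by (rule reactive_trace_test[OF T(2)])
    show "test_state r probe (length \<alpha>) q \<in> states (trace_test T r probe \<alpha>)"
      by (rule test_state_in_trace_test[OF _ q]) simp
  qed (rule success_prob_trace_test[OF L nT T(2)], assumption)+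
  have x: "(s1, q) \<in> states ?M" "(s2, q) \<in> states ?M" using s q by (simp_all add: states_interaction)
  \<comment> \<open>Maximality of a trace is read off from comparing the probed with the plain test
    for every \<open>r\<close>.\<close>
  have "Tr_max ?M (s1, q) = Tr_max ?M (s2, q)"
    using eq[of _ True] eq[of _ False]
    by (simp add: set_eq_iff Tr_max_iff_trace_prob[OF M x(1)] Tr_max_iff_trace_prob[OF M x(2)])
  \<comment> \<open>The plain test, with the original success state \<open>w\<close> in the role of
    \<open>r\<close>.\<close>
  moreover have "SCC_prob ?M w (s1, q) = SCC_prob ?M w (s2, q)"
    using eq[of w False]
    by (simp add: fun_eq_iff SCC_prob_eq_trace_prob[OF M x(1)] SCC_prob_eq_trace_prob[OF M x(2)])
  ultimately show "(SUP \<alpha> \<in> Tr_max ?M (s1, q). SCC_prob ?M w (s1, q) \<alpha>) =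
        (SUP \<alpha> \<in> Tr_max ?M (s2, q). SCC_prob ?M w (s2, q) \<alpha>) \<and>
        (INF \<alpha> \<in> Tr_max ?M (s1, q). SCC_prob ?M w (s1, q) \<alpha>) =
        (INF \<alpha> \<in> Tr_max ?M (s2, q). SCC_prob ?M w (s2, q) \<alpha>)" by simp
qed

theorem theorem4p8:
  fixes L :: "('s, 'a) nplts" and s1 s2 :: 's
  assumes "nplts L" and "s1 \<in> states L" and "s2 \<in> states L"
  shows
    "(fully_nondeterministic L \<longrightarrow>
        (PTe_supinf fully_nondeterministic L s1 s2 \<longleftrightarrow> PTe_forall_exists fully_nondeterministic L s1 s2) \<and>
        (PTe_forall_exists fully_nondeterministic L s1 s2 \<longleftrightarrow> Te_fnd L s1 s2)) \<and>
     (fully_probabilistic L \<longrightarrow>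
        (PTe_supinf fully_probabilistic L s1 s2 \<longleftrightarrow> PTe_forall_exists fully_probabilistic L s1 s2) \<and>
        (PTe_forall_exists fully_probabilistic L s1 s2 \<longleftrightarrow> Te_fpr L s1 s2)) \<and>
     (reactive_probabilistic L \<longrightarrow>
        (PTe_supinf reactive_probabilistic L s1 s2 \<longrightarrow> Te_rpr L s1 s2) \<and>
        (PTe_forall_exists reactive_probabilistic L s1 s2 \<longrightarrow> Te_rpr L s1 s2))"
proof (intro conjI impI)
  assume "fully_nondeterministic L"
  note iff = PTe_fully_nondeterministic[OF assms(1) this assms(2,3)]
  show "PTe_supinf fully_nondeterministic L s1 s2 \<longleftrightarrow> PTe_forall_exists fully_nondeterministic L s1 s2"
    unfolding iff ..
  show "PTe_forall_exists fully_nondeterministic L s1 s2 \<longleftrightarrow> Te_fnd L s1 s2"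
    by (rule iff(2))
next
  assume "fully_probabilistic L"
  note iff = PTe_fully_probabilistic[OF assms(1) this assms(2,3)]
  show "PTe_supinf fully_probabilistic L s1 s2 \<longleftrightarrow> PTe_forall_exists fully_probabilistic L s1 s2"
    unfolding iff ..
  show "PTe_forall_exists fully_probabilistic L s1 s2 \<longleftrightarrow> Te_fpr L s1 s2"
    by (rule iff(2))
next
  assume "reactive_probabilistic L"
  note imp = PTe_reactive_probabilistic[OF assms(1) this assms(2,3)]
  show "PTe_supinf reactive_probabilistic L s1 s2 \<Longrightarrow> Te_rpr L s1 s2"
    by (rule imp[OF disjI1])
  show "PTe_forall_exists reactive_probabilistic L s1 s2 \<Longrightarrow> Te_rpr L s1 s2"
    by (rule imp[OF disjI2])
qed

end
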